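(* Let $\mathcal C$ be a braided monoidal category equipped with a class $\mathcal Q$ of regular epimorphisms satisfying the standing assumptions in the context. Let $(A,t_1,t_2,e)$ be a multiplier bimonoid in $\mathcal C$ such that its multiplication $m:=e1.t_1=1e.t_2$ is non-degenerate and $m$, $e$, $d_1$ and $d_2$ all belong to $\mathcal Q$, where $$d_1:=m1.c^{-1}1.1t_1.c1\colon A^3\to A^2,\qquad d_2:=1m.1c^{-1}.t_21.1c\colon A^3\to A^2 .$$ Then $(A,t_1,t_2,e)$ is a multiplier Hopf monoid (that is, $t_1$ and $t_2$ are isomorphisms) if and only if there is an $\mathbb M$-morphism $s=(s_1,s_2)\colon A\nrightarrow A$ whose components satisfy $$\text{(a)}\quad d_1=t_1.1s_1.t_21,\qquad\qquad \text{(b)}\quad d_2=t_2.s_21.1t_1 .$$ Such an $\mathbb M$-morphism $s$ is unique, and it is dense. (It is called the antipode.)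
   Context: Notation: $\mathcal C$ is a braided monoidal category, written as if strict; the monoidal product (of objects and morphisms) is juxtaposition, the unit is $I$, the braiding is $c_{X,Y}\colon XY\to YX$. The composite of $f\colon A\to B$ and $g\colon B\to C$ is $g.f$ (juxtaposition binds more tightly than the dot); identity morphisms are written $1$; $A^n=A\cdots A$. Subscripts of $c$ are omitted; $c^{-1}\colon XY\to YX$ means $(c_{Y,X})^{-1}$. Standing assumptions: $\mathcal Q$ is a class of regular epimorphisms in $\mathcal C$, closed under composition and monoidal product, containing the isomorphisms, right-cancellative ($s\in\mathcal Q$ and $t.s\in\mathcal Q$ imply $t\in\mathcal Q$), and such that each $q\in \mathcal Q$ is the coequalizer of some pair of morphisms for which this coequalizer is preserved by taking the monoidal product with any fixed object. Semigroups: a semigroup $(A,m)$ is an object with $m\colon A^2\to A$ satisfying $m.m1=m.1m$. It is non-degenerate if for all objects $X,Y$ the maps $\mathcal C(X,YA)\to\mathcal C(XA,YA)$, $f\mapsto 1m.f1$, and $\mathcal C(X,AY)\to\mathcal C(AX,AY)$, $g\mapsto m1.1g$, are injective. $\mathbb M$-morphisms: for a non-degenerate semigroup $(B,m)$ and an object $A$, an $\mathbb M$-morphism $f\colon A\nrightarrow B$ is a pair of morphisms (components) $f_1\colon AB\to B$, $f_2\colon BA\to B$ with $m.1f_1=m.f_21\colon BAB\to B$. It is dense if $f_1,f_2\in\mathcal Q$. Multiplier bimonoid: $(A,t_1,t_2,e)$ with $t_1,t_2\colon A^2\to A^2$, $e\colon A\to I$ such that $t_11.c^{-1}1.1t_1.c1.1t_1=1t_1.t_11$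 and $1e.t_1=1e$; $1t_2.1c^{-1}.t_21.1c.t_21=t_21.1t_2$ and $e1.t_2=e1$; $1t_1.t_21=t_21.1t_1$ and $e1.t_1=1e.t_2$. Then $m:=e1.t_1=1e.t_2$ is associative, making $A$ a semigroup; $d_1$ and $d_2$ are the components of an $\mathbb M$-morphism $d\colon A\nrightarrow A^2$. *)

theory Defs
  imports Main
begin

section \<open>Braided monoidal categories\<close>

text \<open>
  Categories are not assumed to be strict monoidal. Composition is written in the usual
  (right-to-left) order. The fields of the records are only meaningful on objects, arrows and
  composable pairs.
\<close>

record ('o, 'm) cat =
  Obj :: "'o set"
  Arr :: "'m set"
  Dom :: "'m \<Rightarrow> 'o"
  Cod :: "'m \<Rightarrow> 'o"
  Idt :: "'o \<Rightarrow> 'm"  ("\<one>\<index>")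
  Comp :: "'m \<Rightarrow> 'm \<Rightarrow> 'm"  (infixr "\<cdot>\<index>" 65)

record ('o, 'm) monoidal_cat = "('o, 'm) cat" +
  TenO :: "'o \<Rightarrow> 'o \<Rightarrow> 'o"  (infixl "\<odot>\<index>" 70)
  TenA :: "'m \<Rightarrow> 'm \<Rightarrow> 'm"  (infixl "\<otimes>\<index>" 70)
  UnitO :: 'o  ("\<I>\<index>")
  Assoc :: "'o \<Rightarrow> 'o \<Rightarrow> 'o \<Rightarrow> 'm"  ("\<^bold>a\<index>")
  LUnit :: "'o \<Rightarrow> 'm"  ("\<^bold>l\<index>")
  RUnit :: "'o \<Rightarrow> 'm"  ("\<^bold>r\<index>")

record ('o, 'm) braided_cat = "('o, 'm) monoidal_cat" +
  Braid :: "'o \<Rightarrow> 'o \<Rightarrow> 'm"  ("\<^bold>c\<index>")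

definition hom :: "('o, 'm, 'z) cat_scheme \<Rightarrow> 'o \<Rightarrow> 'o \<Rightarrow> 'm set"
  where "hom C X Y = {f \<in> Arr C. Dom C f = X \<and> Cod C f = Y}"

definition inverse_arrows :: "('o, 'm, 'z) cat_scheme \<Rightarrow> 'm \<Rightarrow> 'm \<Rightarrow> bool"
  where "inverse_arrows C f g \<longleftrightarrow>
    f \<in> Arr C \<and> g \<in> hom C (Cod C f) (Dom C f) \<and>
    Comp C g f = Idt C (Dom C f) \<and> Comp C f g = Idt C (Cod C f)"

definition iso :: "('o, 'm, 'z) cat_scheme \<Rightarrow> 'm \<Rightarrow> bool"
  where "iso C f \<longleftrightarrow> (\<exists>g. inverse_arrows C f g)"

definition inv_arr :: "('o, 'm, 'z) cat_scheme \<Rightarrow> 'm \<Rightarrow> 'm"  ("Inv\<index>")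
  where "inv_arr C f = (THE g. inverse_arrows C f g)"

locale category =
  fixes C :: "('o, 'm, 'z) cat_scheme" (structure)
  assumes Dom_Obj: "f \<in> Arr C \<Longrightarrow> Dom C f \<in> Obj C"
    and Cod_Obj: "f \<in> Arr C \<Longrightarrow> Cod C f \<in> Obj C"
    and Idt_hom: "X \<in> Obj C \<Longrightarrow> \<one> X \<in> hom C X X"
    and Comp_hom: "f \<in> hom C X Y \<Longrightarrow> g \<in> hom C Y Z \<Longrightarrow> g \<cdot> f \<in> hom C X Z"
    and Comp_assoc:
      "f \<in> hom C W X \<Longrightarrow> g \<in> hom C X Y \<Longrightarrow> h \<in> hom C Y Z \<Longrightarrow> (h \<cdot> g) \<cdot> f = h \<cdot> (g \<cdot> f)"
    and Comp_Idt_left: "f \<in> hom C X Y \<Longrightarrow> \<one> Y \<cdot> f = f"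
    and Comp_Idt_right: "f \<in> hom C X Y \<Longrightarrow> f \<cdot> \<one> X = f"

locale monoidal_category = category C
  for C :: "('o, 'm, 'z) monoidal_cat_scheme" (structure) +
  assumes UnitO_Obj: "\<I> \<in> Obj C"
    and TenO_Obj: "X \<in> Obj C \<Longrightarrow> Y \<in> Obj C \<Longrightarrow> X \<odot> Y \<in> Obj C"
    and TenA_hom: "f \<in> hom C X X' \<Longrightarrow> g \<in> hom C Y Y' \<Longrightarrow> f \<otimes> g \<in> hom C (X \<odot> Y) (X' \<odot> Y')"
    and TenA_Idt: "X \<in> Obj C \<Longrightarrow> Y \<in> Obj C \<Longrightarrow> \<one> X \<otimes> \<one> Y = \<one> (X \<odot> Y)"
    and TenA_Comp:
      "f \<in> hom C X X' \<Longrightarrow> f' \<in> hom C X' X'' \<Longrightarrow> g \<in> hom C Y Y' \<Longrightarrow> g' \<in> hom C Y' Y'' \<Longrightarrow>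
        (f' \<cdot> f) \<otimes> (g' \<cdot> g) = (f' \<otimes> g') \<cdot> (f \<otimes> g)"
    and Assoc_hom:
      "X \<in> Obj C \<Longrightarrow> Y \<in> Obj C \<Longrightarrow> Z \<in> Obj C \<Longrightarrow>
        \<^bold>a X Y Z \<in> hom C ((X \<odot> Y) \<odot> Z) (X \<odot> (Y \<odot> Z))"
    and Assoc_iso: "X \<in> Obj C \<Longrightarrow> Y \<in> Obj C \<Longrightarrow> Z \<in> Obj C \<Longrightarrow> iso C (\<^bold>a X Y Z)"
    and Assoc_natural:
      "f \<in> hom C X X' \<Longrightarrow> g \<in> hom C Y Y' \<Longrightarrow> h \<in> hom C Z Z' \<Longrightarrow>
        \<^bold>a X' Y' Z' \<cdot> ((f \<otimes> g) \<otimes> h) = (f \<otimes> (g \<otimes> h)) \<cdot> \<^bold>a X Y Z"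
    and LUnit_hom: "X \<in> Obj C \<Longrightarrow> \<^bold>l X \<in> hom C (\<I> \<odot> X) X"
    and LUnit_iso: "X \<in> Obj C \<Longrightarrow> iso C (\<^bold>l X)"
    and LUnit_natural: "f \<in> hom C X X' \<Longrightarrow> \<^bold>l X' \<cdot> (\<one> \<I> \<otimes> f) = f \<cdot> \<^bold>l X"
    and RUnit_hom: "X \<in> Obj C \<Longrightarrow> \<^bold>r X \<in> hom C (X \<odot> \<I>) X"
    and RUnit_iso: "X \<in> Obj C \<Longrightarrow> iso C (\<^bold>r X)"
    and RUnit_natural: "f \<in> hom C X X' \<Longrightarrow> \<^bold>r X' \<cdot> (f \<otimes> \<one> \<I>) = f \<cdot> \<^bold>r X"
    and pentagon:
      "W \<in> Obj C \<Longrightarrow> X \<in> Obj C \<Longrightarrow> Y \<in> Obj C \<Longrightarrow> Z \<in> Obj C \<Longrightarrow>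
        (\<one> W \<otimes> \<^bold>a X Y Z) \<cdot> \<^bold>a W (X \<odot> Y) Z \<cdot> (\<^bold>a W X Y \<otimes> \<one> Z)
          = \<^bold>a W X (Y \<odot> Z) \<cdot> \<^bold>a (W \<odot> X) Y Z"
    and triangle:
      "X \<in> Obj C \<Longrightarrow> Y \<in> Obj C \<Longrightarrow> (\<one> X \<otimes> \<^bold>l Y) \<cdot> \<^bold>a X \<I> Y = \<^bold>r X \<otimes> \<one> Y"

locale braided_monoidal_category = monoidal_category C
  for C :: "('o, 'm, 'z) braided_cat_scheme" (structure) +
  assumes Braid_hom: "X \<in> Obj C \<Longrightarrow> Y \<in> Obj C \<Longrightarrow> \<^bold>c X Y \<in> hom C (X \<odot> Y) (Y \<odot> X)"
    and Braid_iso: "X \<in> Obj C \<Longrightarrow> Y \<in> Obj C \<Longrightarrow> iso C (\<^bold>c X Y)"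
    and Braid_natural:
      "f \<in> hom C X X' \<Longrightarrow> g \<in> hom C Y Y' \<Longrightarrow> \<^bold>c X' Y' \<cdot> (f \<otimes> g) = (g \<otimes> f) \<cdot> \<^bold>c X Y"
    and hexagon1:
      "X \<in> Obj C \<Longrightarrow> Y \<in> Obj C \<Longrightarrow> Z \<in> Obj C \<Longrightarrow>
        \<^bold>a Y Z X \<cdot> \<^bold>c X (Y \<odot> Z) \<cdot> \<^bold>a X Y Z
          = (\<one> Y \<otimes> \<^bold>c X Z) \<cdot> \<^bold>a Y X Z \<cdot> (\<^bold>c X Y \<otimes> \<one> Z)"
    and hexagon2:
      "X \<in> Obj C \<Longrightarrow> Y \<in> Obj C \<Longrightarrow> Z \<in> Obj C \<Longrightarrow>
        Inv (\<^bold>a Z X Y) \<cdot> \<^bold>c (X \<odot> Y) Z \<cdot> Inv (\<^bold>a X Y Z)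
          = (\<^bold>c X Z \<otimes> \<one> Y) \<cdot> Inv (\<^bold>a X Z Y) \<cdot> (\<one> X \<otimes> \<^bold>c Y Z)"


section \<open>The class of regular epimorphisms\<close>

definition coequalizer :: "('o, 'm, 'z) cat_scheme \<Rightarrow> 'm \<Rightarrow> 'm \<Rightarrow> 'm \<Rightarrow> bool"
  where "coequalizer C f g q \<longleftrightarrow>
    f \<in> Arr C \<and> g \<in> hom C (Dom C f) (Cod C f) \<and> q \<in> Arr C \<and> Dom C q = Cod C f \<and>
    Comp C q f = Comp C q g \<and>
    (\<forall>Z. \<forall>h \<in> hom C (Cod C f) Z. Comp C h f = Comp C h g \<longrightarrow>
      (\<exists>!k. k \<in> hom C (Cod C q) Z \<and> Comp C k q = h))"

definition regular_epi :: "('o, 'm, 'z) cat_scheme \<Rightarrow> 'm \<Rightarrow> bool"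
  where "regular_epi C q \<longleftrightarrow> (\<exists>f g. coequalizer C f g q)"

locale regular_epi_class = monoidal_category C
  for C :: "('o, 'm, 'z) monoidal_cat_scheme" (structure) +
  fixes Q :: "'m set"
  assumes Q_regular_epi: "q \<in> Q \<Longrightarrow> regular_epi C q"
    and Q_Comp: "s \<in> Q \<Longrightarrow> t \<in> Q \<Longrightarrow> Dom C t = Cod C s \<Longrightarrow> t \<cdot> s \<in> Q"
    and Q_TenA: "s \<in> Q \<Longrightarrow> t \<in> Q \<Longrightarrow> s \<otimes> t \<in> Q"
    and Q_iso: "iso C f \<Longrightarrow> f \<in> Q"
    and Q_right_cancel:
      "s \<in> Q \<Longrightarrow> t \<in> Arr C \<Longrightarrow> Dom C t = Cod C s \<Longrightarrow> t \<cdot> s \<in> Q \<Longrightarrow> t \<in> Q"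
    and Q_preserved:
      "q \<in> Q \<Longrightarrow> \<exists>f g. coequalizer C f g q \<and>
        (\<forall>X \<in> Obj C. coequalizer C (\<one> X \<otimes> f) (\<one> X \<otimes> g) (\<one> X \<otimes> q) \<and>
                       coequalizer C (f \<otimes> \<one> X) (g \<otimes> \<one> X) (q \<otimes> \<one> X))"


section \<open>Semigroups and \<open>\<bbbM>\<close>-morphisms\<close>

definition semigroup_obj :: "('o, 'm, 'z) monoidal_cat_scheme \<Rightarrow> 'o \<Rightarrow> 'm \<Rightarrow> bool"
  where "semigroup_obj C A m \<longleftrightarrow>
    A \<in> Obj C \<and> m \<in> hom C (A \<odot> A) A \<and>
    m \<cdot> (m \<otimes> \<one> A) = m \<cdot> (\<one> A \<otimes> m) \<cdot> \<^bold>a A A A"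
  for C (structure)

definition nondegenerate :: "('o, 'm, 'z) monoidal_cat_scheme \<Rightarrow> 'o \<Rightarrow> 'm \<Rightarrow> bool"
  where "nondegenerate C A m \<longleftrightarrow>
    (\<forall>X \<in> Obj C. \<forall>Y \<in> Obj C.
      inj_on (\<lambda>f. (\<one> Y \<otimes> m) \<cdot> \<^bold>a Y A A \<cdot> (f \<otimes> \<one> A)) (hom C X (Y \<odot> A)) \<and>
      inj_on (\<lambda>g. (m \<otimes> \<one> Y) \<cdot> Inv (\<^bold>a A A Y) \<cdot> (\<one> A \<otimes> g)) (hom C X (A \<odot> Y)))"
  for C (structure)

text \<open>\<open>M_morphism C A B m f\<close>: the pair \<open>f\<close> is an \<open>\<bbbM>\<close>-morphism from the object \<open>A\<close> to the
  non-degenerate semigroup \<open>(B, m)\<close>. The compatibility condition is read on \<open>(B \<odot> A) \<odot> B\<close>.\<close>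

definition M_morphism ::
  "('o, 'm, 'z) monoidal_cat_scheme \<Rightarrow> 'o \<Rightarrow> 'o \<Rightarrow> 'm \<Rightarrow> 'm \<times> 'm \<Rightarrow> bool"
  where "M_morphism C A B m f \<longleftrightarrow>
    A \<in> Obj C \<and> semigroup_obj C B m \<and> nondegenerate C B m \<and>
    fst f \<in> hom C (A \<odot> B) B \<and> snd f \<in> hom C (B \<odot> A) B \<and>
    m \<cdot> (\<one> B \<otimes> fst f) \<cdot> \<^bold>a B A B = m \<cdot> (snd f \<otimes> \<one> B)"
  for C (structure)

definition dense_M :: "'m set \<Rightarrow> 'm \<times> 'm \<Rightarrow> bool"
  where "dense_M Q f \<longleftrightarrow> fst f \<in> Q \<and> snd f \<in> Q"


section \<open>Multiplier bimonoids and multiplier Hopf monoids\<close>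

text \<open>The triple product of \<open>A\<close> is bracketed as \<open>(A \<odot> A) \<odot> A\<close>. On it, \<open>f\<close> acting on the first
  two factors is \<open>f \<otimes> \<one> A\<close>, and \<open>f\<close> (an endomorphism of \<open>A \<odot> A\<close>) acting on the last two is \<open>on23 C A f\<close>.\<close>

definition on23 :: "('o, 'm, 'z) monoidal_cat_scheme \<Rightarrow> 'o \<Rightarrow> 'm \<Rightarrow> 'm"
  where "on23 C A f = Inv (\<^bold>a A A A) \<cdot> (\<one> A \<otimes> f) \<cdot> \<^bold>a A A A"
  for C (structure)

definition multiplier_bimonoid ::
  "('o, 'm, 'z) braided_cat_scheme \<Rightarrow> 'o \<Rightarrow> 'm \<Rightarrow> 'm \<Rightarrow> 'm \<Rightarrow> bool"
  where "multiplier_bimonoid C A t1 t2 e \<longleftrightarrow>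
    A \<in> Obj C \<and>
    t1 \<in> hom C (A \<odot> A) (A \<odot> A) \<and> t2 \<in> hom C (A \<odot> A) (A \<odot> A) \<and> e \<in> hom C A \<I> \<and>
    (t1 \<otimes> \<one> A) \<cdot> (Inv (\<^bold>c A A) \<otimes> \<one> A) \<cdot> on23 C A t1 \<cdot> (\<^bold>c A A \<otimes> \<one> A) \<cdot> on23 C A t1
      = on23 C A t1 \<cdot> (t1 \<otimes> \<one> A) \<and>
    (\<one> A \<otimes> e) \<cdot> t1 = \<one> A \<otimes> e \<and>
    on23 C A t2 \<cdot> on23 C A (Inv (\<^bold>c A A)) \<cdot> (t2 \<otimes> \<one> A) \<cdot> on23 C A (\<^bold>c A A) \<cdot> (t2 \<otimes> \<one> A)
      = (t2 \<otimes> \<one> A) \<cdot> on23 C A t2 \<and>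
    (e \<otimes> \<one> A) \<cdot> t2 = e \<otimes> \<one> A \<and>
    on23 C A t1 \<cdot> (t2 \<otimes> \<one> A) = (t2 \<otimes> \<one> A) \<cdot> on23 C A t1 \<and>
    \<^bold>l A \<cdot> (e \<otimes> \<one> A) \<cdot> t1 = \<^bold>r A \<cdot> (\<one> A \<otimes> e) \<cdot> t2"
  for C (structure)

definition bimonoid_mult :: "('o, 'm, 'z) braided_cat_scheme \<Rightarrow> 'o \<Rightarrow> 'm \<Rightarrow> 'm \<Rightarrow> 'm"
  where "bimonoid_mult C A t1 e = \<^bold>l A \<cdot> (e \<otimes> \<one> A) \<cdot> t1"
  for C (structure)

definition bimonoid_d1 :: "('o, 'm, 'z) braided_cat_scheme \<Rightarrow> 'o \<Rightarrow> 'm \<Rightarrow> 'm \<Rightarrow> 'm"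
  where "bimonoid_d1 C A t1 e =
    (bimonoid_mult C A t1 e \<otimes> \<one> A) \<cdot> (Inv (\<^bold>c A A) \<otimes> \<one> A) \<cdot> on23 C A t1 \<cdot> (\<^bold>c A A \<otimes> \<one> A)"
  for C (structure)

text \<open>The multiplication in \<open>d\<^sub>2\<close> is the same one as in \<open>d\<^sub>1\<close>, hence the argument \<open>t1\<close>.\<close>

definition bimonoid_d2 :: "('o, 'm, 'z) braided_cat_scheme \<Rightarrow> 'o \<Rightarrow> 'm \<Rightarrow> 'm \<Rightarrow> 'm \<Rightarrow> 'm"
  where "bimonoid_d2 C A t1 t2 e =
    (\<one> A \<otimes> bimonoid_mult C A t1 e) \<cdot> \<^bold>a A A A \<cdot>
      on23 C A (Inv (\<^bold>c A A)) \<cdot> (t2 \<otimes> \<one> A) \<cdot> on23 C A (\<^bold>c A A)"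
  for C (structure)

definition multiplier_Hopf_monoid ::
  "('o, 'm, 'z) braided_cat_scheme \<Rightarrow> 'o \<Rightarrow> 'm \<Rightarrow> 'm \<Rightarrow> 'm \<Rightarrow> bool"
  where "multiplier_Hopf_monoid C A t1 t2 e \<longleftrightarrow>
    multiplier_bimonoid C A t1 t2 e \<and> iso C t1 \<and> iso C t2"

definition antipode ::
  "('o, 'm, 'z) braided_cat_scheme \<Rightarrow> 'o \<Rightarrow> 'm \<Rightarrow> 'm \<Rightarrow> 'm \<Rightarrow> 'm \<times> 'm \<Rightarrow> bool"
  where "antipode C A t1 t2 e s \<longleftrightarrow>
    M_morphism C A A (bimonoid_mult C A t1 e) s \<and>
    bimonoid_d1 C A t1 e = t1 \<cdot> (\<one> A \<otimes> fst s) \<cdot> \<^bold>a A A A \<cdot> (t2 \<otimes> \<one> A) \<and>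
    bimonoid_d2 C A t1 t2 e = t2 \<cdot> (snd s \<otimes> \<one> A) \<cdot> on23 C A t1"
  for C (structure)

end

theory Submission
  imports Defs
begin

text \<open>
  In the strict notation, put \<open>s\<^sub>1 = e1.t\<^sub>1\<^sup>-\<^sup>1\<close> and \<open>s\<^sub>2 = 1e.t\<^sub>2\<^sup>-\<^sup>1\<close> if the fusion morphisms are
  invertible. Applying \<open>e11\<close> to the fusion equation gives \<open>d\<^sub>1.1t\<^sub>1 = t\<^sub>1.m1\<close>; with \<open>m = 1e.t\<^sub>2\<close> and
  \<open>1t\<^sub>1.t\<^sub>21 = t\<^sub>21.1t\<^sub>1\<close> this turns into (a). Composing (b) with \<open>1e\<close> gives the cancellation law
  \<open>m.s\<^sub>21.1t\<^sub>1 = m.1e1\<close>, which yields the compatibility of \<open>s\<^sub>1\<close> and \<open>s\<^sub>2\<close>.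
  Conversely, the cancellation law expresses \<open>m1.1f\<close>, up to braidings and a further
  multiplication, by \<open>t\<^sub>1.f\<close>, so that \<open>t\<^sub>1\<close> is monic by non-degeneracy; by (a) the regular
  epimorphism \<open>d\<^sub>1\<close> factorizes through \<open>t\<^sub>1\<close>, so \<open>t\<^sub>1\<close> is invertible. Once \<open>t\<^sub>1\<close> and \<open>t\<^sub>2\<close> are invertible,
  (a) determines \<open>1s\<^sub>1\<close> and hence \<open>s\<^sub>1\<close>, because \<open>e11\<close> is epic. The statements about \<open>t\<^sub>2\<close>, (b) and \<open>s\<^sub>2\<close>
  follow by reversing the monoidal product.
\<close>

section \<open>Categories\<close>

lemma hom_iff: "f \<in> hom C X Y \<longleftrightarrow> f \<in> Arr C \<and> Dom C f = X \<and> Cod C f = Y"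
  by (auto simp: hom_def)

context category
begin

declare Dom_Obj [simp] Cod_Obj [simp]

lemma Idt_simps [simp]:
  assumes "X \<in> Obj C"
  shows "\<one> X \<in> Arr C" "Dom C (\<one> X) = X" "Cod C (\<one> X) = X"
  using Idt_hom [OF assms] by (auto simp: hom_iff)

lemma Comp_simps [simp]:
  assumes "f \<in> Arr C" "g \<in> Arr C" "Dom C g = Cod C f"
  shows "g \<cdot> f \<in> Arr C" "Dom C (g \<cdot> f) = Dom C f" "Cod C (g \<cdot> f) = Cod C g"
  using Comp_hom [of f "Dom C f" "Cod C f" g "Cod C g"] assms by (auto simp: hom_iff)

lemma Comp_assoc' [simp]:
  "\<lbrakk>f \<in> Arr C; g \<in> Arr C; h \<in> Arr C; Dom C g = Cod C f; Dom C h = Cod C g\<rbrakk>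
    \<Longrightarrow> (h \<cdot> g) \<cdot> f = h \<cdot> (g \<cdot> f)"
  by (rule Comp_assoc) (auto simp: hom_iff)

lemma Comp_Idt [simp]:
  shows "f \<in> Arr C \<Longrightarrow> Cod C f = Y \<Longrightarrow> \<one> Y \<cdot> f = f"
    and "f \<in> Arr C \<Longrightarrow> Dom C f = X \<Longrightarrow> f \<cdot> \<one> X = f"
  by (metis Comp_Idt_left hom_iff) (metis Comp_Idt_right hom_iff)

lemma Comp_cong_right:
  assumes "g \<cdot> f = k"
    and "f \<in> Arr C" "g \<in> Arr C" "h \<in> Arr C" "Dom C g = Cod C f" "Dom C f = Cod C h"
  shows "g \<cdot> (f \<cdot> h) = k \<cdot> h"
  using assms by (metis Comp_assoc')

lemma inverse_arrows_unique:
  assumes "inverse_arrows C f g" "inverse_arrows C f h"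
  shows "g = h"
proof -
  have "g = g \<cdot> (f \<cdot> h)" using assms by (simp add: inverse_arrows_def hom_iff)
  also have "\<dots> = (g \<cdot> f) \<cdot> h"
    by (rule Comp_assoc' [symmetric]) (use assms in \<open>auto simp: inverse_arrows_def hom_iff\<close>)
  also have "\<dots> = h" using assms by (simp add: inverse_arrows_def hom_iff)
  finally show ?thesis .
qed

lemma inv_arr_eq: "inverse_arrows C f g \<Longrightarrow> Inv f = g"
  unfolding inv_arr_def using inverse_arrows_unique by blast

lemma inverse_arrows_Inv: "iso C f \<Longrightarrow> inverse_arrows C f (Inv f)"
  using inv_arr_eq by (auto simp: iso_def)

lemma iso_Arr: "iso C f \<Longrightarrow> f \<in> Arr C"
  by (auto simp: iso_def inverse_arrows_def)

lemma Inv_simps [simp]: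
  assumes "iso C f"
  shows "Inv f \<in> Arr C" "Dom C (Inv f) = Cod C f" "Cod C (Inv f) = Dom C f"
  using inverse_arrows_Inv [OF assms] by (auto simp: inverse_arrows_def hom_iff)

lemma Inv_cancel [simp]:
  assumes "iso C f"
  shows "Inv f \<cdot> f = \<one> (Dom C f)" "f \<cdot> Inv f = \<one> (Cod C f)"
  using inverse_arrows_Inv [OF assms] by (auto simp: inverse_arrows_def hom_iff)

lemma Inv_cancel_assoc [simp]:
  assumes "iso C f" "h \<in> Arr C"
  shows "Cod C h = Dom C f \<Longrightarrow> Inv f \<cdot> (f \<cdot> h) = h"
    and "Cod C h = Cod C f \<Longrightarrow> f \<cdot> (Inv f \<cdot> h) = h"
  using assms iso_Arr [OF assms(1)] by (simp_all add: Comp_cong_right [OF Inv_cancel(1)]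
    Comp_cong_right [OF Inv_cancel(2)])

lemma inverse_arrows_iso: "inverse_arrows C f g \<Longrightarrow> iso C f"
  by (auto simp: iso_def)

lemma inverse_arrows_sym: "inverse_arrows C f g \<Longrightarrow> inverse_arrows C g f"
  by (auto simp: inverse_arrows_def hom_iff)

lemma iso_Inv [simp]: "iso C f \<Longrightarrow> iso C (Inv f)"
  and Inv_Inv [simp]: "iso C f \<Longrightarrow> Inv (Inv f) = f"
  by (blast intro: inverse_arrows_iso inv_arr_eq inverse_arrows_sym inverse_arrows_Inv)+

lemma inverse_arrows_Comp:
  assumes "iso C f" "iso C g" "Dom C g = Cod C f"
  shows "inverse_arrows C (g \<cdot> f) (Inv f \<cdot> Inv g)"
  using assms iso_Arr by (auto simp: inverse_arrows_def hom_iff)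

lemma iso_Comp [simp]: "\<lbrakk>iso C f; iso C g; Dom C g = Cod C f\<rbrakk> \<Longrightarrow> iso C (g \<cdot> f)"
  and Inv_Comp [simp]: "\<lbrakk>iso C f; iso C g; Dom C g = Cod C f\<rbrakk> \<Longrightarrow> Inv (g \<cdot> f) = Inv f \<cdot> Inv g"
  by (blast intro: inverse_arrows_iso inv_arr_eq inverse_arrows_Comp)+

lemma inverse_arrows_Idt: "X \<in> Obj C \<Longrightarrow> inverse_arrows C (\<one> X) (\<one> X)"
  by (simp add: inverse_arrows_def hom_iff)

lemma iso_Idt [simp]: "X \<in> Obj C \<Longrightarrow> iso C (\<one> X)"
  and Inv_Idt [simp]: "X \<in> Obj C \<Longrightarrow> Inv (\<one> X) = \<one> X"
  by (blast intro: inverse_arrows_iso inv_arr_eq inverse_arrows_Idt)+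

lemma iso_cancel_left:
  assumes "f \<cdot> g = f \<cdot> h" "iso C f" "g \<in> Arr C" "h \<in> Arr C" "Cod C g = Dom C f" "Cod C h = Dom C f"
  shows "g = h"
proof -
  have "g = Inv f \<cdot> (f \<cdot> g)" using assms(2-) by simp
  also have "\<dots> = h" unfolding assms(1) using assms(2-) by simp
  finally show ?thesis .
qed

lemma iso_cancel_right:
  assumes "g \<cdot> f = h \<cdot> f" "iso C f" "g \<in> Arr C" "h \<in> Arr C" "Dom C g = Cod C f" "Dom C h = Cod C f"
  shows "g = h"
proof -
  have "g = (g \<cdot> f) \<cdot> Inv f" using assms(2-) iso_Arr [OF assms(2)] by simp
  also have "\<dots> = h" unfolding assms(1) using assms(2-) iso_Arr [OF assms(2)] by simp
  finally show ?thesis .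
qed

lemma coequalizerD:
  assumes "coequalizer C u v q"
  shows "u \<in> Arr C" "v \<in> Arr C" "Dom C v = Dom C u" "Cod C v = Cod C u"
    "q \<in> Arr C" "Dom C q = Cod C u" "q \<cdot> u = q \<cdot> v"
  using assms unfolding coequalizer_def hom_iff by blast+

lemma coequalizer_epi:
  assumes "coequalizer C u v q" "g \<cdot> q = h \<cdot> q"
    and "g \<in> Arr C" "h \<in> Arr C" "Dom C g = Cod C q" "Dom C h = Cod C q"
  shows "g = h"
proof -
  note q = coequalizerD [OF assms(1)]
  have gh: "Cod C g = Cod C h"
    using arg_cong [OF assms(2), of "Cod C"] q assms(3-) by simp
  have "(h \<cdot> q) \<cdot> u = (h \<cdot> q) \<cdot> v" using q assms by simp
  moreover have "h \<cdot> q \<in> hom C (Cod C u) (Cod C h)" using q assms by (simp add: hom_iff)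
  ultimately have "\<exists>!k. k \<in> hom C (Cod C q) (Cod C h) \<and> k \<cdot> q = h \<cdot> q"
    using assms(1) unfolding coequalizer_def by blast
  moreover have "g \<in> hom C (Cod C q) (Cod C h)" "h \<in> hom C (Cod C q) (Cod C h)"
    using assms(3-) gh by (simp_all add: hom_iff)
  ultimately show ?thesis using assms(2) by blast
qed

lemma coequalizer_factor:
  assumes "coequalizer C u v q" "x \<in> Arr C" "Dom C x = Dom C q" "x \<cdot> u = x \<cdot> v"
  obtains k where "k \<in> hom C (Cod C q) (Cod C x)" "k \<cdot> q = x"
proof -
  have "x \<in> hom C (Cod C u) (Cod C x)" using assms(2,3) coequalizerD [OF assms(1)] by (simp add: hom_iff)
  then have "\<exists>!k. k \<in> hom C (Cod C q) (Cod C x) \<and> k \<cdot> q = x"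
    using assms(1,4) by (simp only: coequalizer_def)
  then show thesis using that by (elim ex1E conjE)
qed

lemma iso_if_mono_comp_coequalizer:
  assumes mono: "\<And>X f g. \<lbrakk>f \<in> hom C X (Dom C t); g \<in> hom C X (Dom C t); t \<cdot> f = t \<cdot> g\<rbrakk> \<Longrightarrow> f = g"
    and q: "coequalizer C u v (t \<cdot> x)"
    and t: "t \<in> Arr C" "x \<in> Arr C" "Dom C t = Cod C x"
  shows "iso C t"
proof -
  have q': "Dom C x = Cod C u" "u \<in> Arr C" "v \<in> Arr C" "Dom C v = Dom C u" "Cod C v = Cod C u"
    and tx: "(t \<cdot> x) \<cdot> u = (t \<cdot> x) \<cdot> v"
    using coequalizerD [OF q] t by simp_all
  have "x \<cdot> u = x \<cdot> v"
    by (rule mono [of _ "Dom C u"]) (use q' tx t in \<open>simp_all add: hom_iff\<close>)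
  then obtain k where k: "k \<in> hom C (Cod C (t \<cdot> x)) (Cod C x)" "k \<cdot> (t \<cdot> x) = x"
    using coequalizer_factor [OF q, of x] t by auto
  then have k': "k \<in> Arr C" "Dom C k = Cod C t" "Cod C k = Dom C t" using t by (auto simp: hom_iff)
  have tk: "t \<cdot> k = \<one> (Cod C t)"
    by (rule coequalizer_epi [OF q]) (use k' k(2) t in auto)
  have "t \<cdot> (k \<cdot> t) = (t \<cdot> k) \<cdot> t" using k' t by (intro Comp_assoc' [symmetric]) auto
  also have "\<dots> = t \<cdot> \<one> (Dom C t)" using t by (simp add: tk)
  finally have "k \<cdot> t = \<one> (Dom C t)"
    by (rule mono [of _ "Dom C t", rotated 2]) (use k' t in \<open>simp_all add: hom_iff\<close>)
  then show ?thesis using k' t tk by (auto simp: iso_def inverse_arrows_def hom_iff)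
qed

end

section \<open>Monoidal categories\<close>

context monoidal_category
begin

declare UnitO_Obj [simp] TenO_Obj [simp] TenA_Idt [simp] Assoc_iso [simp] LUnit_iso [simp] RUnit_iso [simp]

lemma TenA_simps [simp]:
  assumes "f \<in> Arr C" "g \<in> Arr C"
  shows "f \<otimes> g \<in> Arr C" "Dom C (f \<otimes> g) = Dom C f \<odot> Dom C g" "Cod C (f \<otimes> g) = Cod C f \<odot> Cod C g"
  using TenA_hom [of f "Dom C f" "Cod C f" g "Dom C g" "Cod C g"] assms by (auto simp: hom_iff)

lemma interchange [simp]:
  assumes "f \<in> Arr C" "f' \<in> Arr C" "g \<in> Arr C" "g' \<in> Arr C" "Dom C f' = Cod C f" "Dom C g' = Cod C g"
  shows "(f' \<otimes> g') \<cdot> (f \<otimes> g) = (f' \<cdot> f) \<otimes> (g' \<cdot> g)"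
  by (rule TenA_Comp [symmetric]) (use assms in \<open>auto simp: hom_iff\<close>)

lemma interchange_assoc [simp]:
  assumes "f \<in> Arr C" "f' \<in> Arr C" "g \<in> Arr C" "g' \<in> Arr C" "Dom C f' = Cod C f" "Dom C g' = Cod C g"
    and "h \<in> Arr C" "Cod C h = Dom C f \<odot> Dom C g"
  shows "(f' \<otimes> g') \<cdot> ((f \<otimes> g) \<cdot> h) = ((f' \<cdot> f) \<otimes> (g' \<cdot> g)) \<cdot> h"
  by (rule Comp_cong_right) (use assms in auto)

lemma Assoc_simps [simp]:
  assumes "X \<in> Obj C" "Y \<in> Obj C" "Z \<in> Obj C"
  shows "\<^bold>a X Y Z \<in> Arr C" "Dom C (\<^bold>a X Y Z) = (X \<odot> Y) \<odot> Z" "Cod C (\<^bold>a X Y Z) = X \<odot> (Y \<odot> Z)"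
  using Assoc_hom [OF assms] by (auto simp: hom_iff)

lemma LUnit_simps [simp]:
  assumes "X \<in> Obj C"
  shows "\<^bold>l X \<in> Arr C" "Dom C (\<^bold>l X) = \<I> \<odot> X" "Cod C (\<^bold>l X) = X"
  using LUnit_hom [OF assms] by (auto simp: hom_iff)

lemma RUnit_simps [simp]:
  assumes "X \<in> Obj C"
  shows "\<^bold>r X \<in> Arr C" "Dom C (\<^bold>r X) = X \<odot> \<I>" "Cod C (\<^bold>r X) = X"
  using RUnit_hom [OF assms] by (auto simp: hom_iff)

lemma inverse_arrows_TenA:
  assumes "iso C f" "iso C g"
  shows "inverse_arrows C (f \<otimes> g) (Inv f \<otimes> Inv g)"
  using assms iso_Arr by (auto simp: inverse_arrows_def hom_iff)

lemma iso_TenA [simp]: "\<lbrakk>iso C f; iso C g\<rbrakk> \<Longrightarrow> iso C (f \<otimes> g)"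
  and Inv_TenA [simp]: "\<lbrakk>iso C f; iso C g\<rbrakk> \<Longrightarrow> Inv (f \<otimes> g) = Inv f \<otimes> Inv g"
  by (blast intro: inverse_arrows_iso inv_arr_eq inverse_arrows_TenA)+

lemma Assoc_nat:
  assumes "f \<in> Arr C" "g \<in> Arr C" "h \<in> Arr C" "Cod C f = X" "Cod C g = Y" "Cod C h = Z"
  shows "\<^bold>a X Y Z \<cdot> ((f \<otimes> g) \<otimes> h) = (f \<otimes> (g \<otimes> h)) \<cdot> \<^bold>a (Dom C f) (Dom C g) (Dom C h)"
  using assms by (auto intro: Assoc_natural simp: hom_iff)

lemma Inv_Assoc_nat:
  assumes "f \<in> Arr C" "g \<in> Arr C" "h \<in> Arr C" "Cod C f = X" "Cod C g = Y" "Cod C h = Z"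
  shows "Inv (\<^bold>a X Y Z) \<cdot> (f \<otimes> (g \<otimes> h)) = ((f \<otimes> g) \<otimes> h) \<cdot> Inv (\<^bold>a (Dom C f) (Dom C g) (Dom C h))"
proof -
  let ?a = "\<^bold>a (Dom C f) (Dom C g) (Dom C h)"
  have "Inv (\<^bold>a X Y Z) \<cdot> (f \<otimes> (g \<otimes> h)) = Inv (\<^bold>a X Y Z) \<cdot> ((f \<otimes> (g \<otimes> h)) \<cdot> ?a) \<cdot> Inv ?a"
    using assms by auto
  also have "\<dots> = Inv (\<^bold>a X Y Z) \<cdot> (\<^bold>a X Y Z \<cdot> ((f \<otimes> g) \<otimes> h)) \<cdot> Inv ?a"
    by (simp only: Assoc_nat [OF assms])
  also have "\<dots> = ((f \<otimes> g) \<otimes> h) \<cdot> Inv ?a"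
    using assms by auto
  finally show ?thesis .
qed

lemma LUnit_nat:
  assumes "f \<in> Arr C" "Cod C f = X"
  shows "\<^bold>l X \<cdot> (\<one> \<I> \<otimes> f) = f \<cdot> \<^bold>l (Dom C f)"
  using assms by (auto intro: LUnit_natural simp: hom_iff)

lemma RUnit_nat:
  assumes "f \<in> Arr C" "Cod C f = X"
  shows "\<^bold>r X \<cdot> (f \<otimes> \<one> \<I>) = f \<cdot> \<^bold>r (Dom C f)"
  using assms by (auto intro: RUnit_natural simp: hom_iff)

lemma TenA_unit_left_cancel:
  assumes "\<one> \<I> \<otimes> f = \<one> \<I> \<otimes> g" "f \<in> Arr C" "g \<in> Arr C" "Dom C g = Dom C f" "Cod C g = Cod C f"
  shows "f = g"
proof (rule iso_cancel_right [where f = "\<^bold>l (Dom C f)"])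
  show "f \<cdot> \<^bold>l (Dom C f) = g \<cdot> \<^bold>l (Dom C f)"
    using LUnit_nat [of f "Cod C f"] LUnit_nat [of g "Cod C f"] assms by simp
qed (use assms in auto)

lemma TenA_unit_right_cancel:
  assumes "f \<otimes> \<one> \<I> = g \<otimes> \<one> \<I>" "f \<in> Arr C" "g \<in> Arr C" "Dom C g = Dom C f" "Cod C g = Cod C f"
  shows "f = g"
proof (rule iso_cancel_right [where f = "\<^bold>r (Dom C f)"])
  show "f \<cdot> \<^bold>r (Dom C f) = g \<cdot> \<^bold>r (Dom C f)"
    using RUnit_nat [of f "Cod C f"] RUnit_nat [of g "Cod C f"] assms by simp
qed (use assms in auto)

lemma LUnit_TenO:
  assumes [simp]: "X \<in> Obj C" "Y \<in> Obj C"
  shows "\<^bold>l (X \<odot> Y) \<cdot> \<^bold>a \<I> X Y = \<^bold>l X \<otimes> \<one> Y"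
proof (rule TenA_unit_left_cancel)
  let ?b = "\<^bold>a \<I> (\<I> \<odot> X) Y \<cdot> (\<^bold>a \<I> \<I> X \<otimes> \<one> Y)"
  have "(\<one> \<I> \<otimes> \<^bold>l (X \<odot> Y)) \<cdot> ((\<one> \<I> \<otimes> \<^bold>a \<I> X Y) \<cdot> ?b)
    = (\<one> \<I> \<otimes> \<^bold>l (X \<odot> Y)) \<cdot> (\<^bold>a \<I> \<I> (X \<odot> Y) \<cdot> \<^bold>a (\<I> \<odot> \<I>) X Y)"
    by (simp only: pentagon [of \<I> \<I> X Y] assms UnitO_Obj)
  also have "\<dots> = ((\<one> \<I> \<otimes> \<^bold>l (X \<odot> Y)) \<cdot> \<^bold>a \<I> \<I> (X \<odot> Y)) \<cdot> \<^bold>a (\<I> \<odot> \<I>) X Y"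
    by simp
  also have "\<dots> = (\<^bold>r \<I> \<otimes> \<one> (X \<odot> Y)) \<cdot> \<^bold>a (\<I> \<odot> \<I>) X Y"
    by (simp only: triangle assms UnitO_Obj TenO_Obj)
  also have "\<dots> = \<^bold>a \<I> X Y \<cdot> ((\<^bold>r \<I> \<otimes> \<one> X) \<otimes> \<one> Y)"
    by (subst Assoc_nat) simp_all
  also have "\<dots> = \<^bold>a \<I> X Y \<cdot> (((\<one> \<I> \<otimes> \<^bold>l X) \<cdot> \<^bold>a \<I> \<I> X) \<otimes> \<one> Y)"
    by (simp only: triangle assms UnitO_Obj TenO_Obj)
  also have "\<dots> = (\<^bold>a \<I> X Y \<cdot> ((\<one> \<I> \<otimes> \<^bold>l X) \<otimes> \<one> Y)) \<cdot> (\<^bold>a \<I> \<I> X \<otimes> \<one> Y)"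
    by simp
  also have "\<dots> = (\<one> \<I> \<otimes> (\<^bold>l X \<otimes> \<one> Y)) \<cdot> ?b"
    by (subst Assoc_nat) simp_all
  finally show "\<one> \<I> \<otimes> (\<^bold>l (X \<odot> Y) \<cdot> \<^bold>a \<I> X Y) = \<one> \<I> \<otimes> (\<^bold>l X \<otimes> \<one> Y)"
    by (intro iso_cancel_right [where f = ?b and g = "\<one> \<I> \<otimes> (\<^bold>l (X \<odot> Y) \<cdot> \<^bold>a \<I> X Y)"]) simp_all
qed simp_all

end

section \<open>Braided monoidal categories\<close>

context braided_monoidal_category
begin

declare Braid_iso [simp]

lemma Braid_simps [simp]:
  assumes "X \<in> Obj C" "Y \<in> Obj C"
  shows "\<^bold>c X Y \<in> Arr C" "Dom C (\<^bold>c X Y) = X \<odot> Y" "Cod C (\<^bold>c X Y) = Y \<odot> X"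
  using Braid_hom [OF assms] by (auto simp: hom_iff)

lemma Braid_nat:
  assumes "f \<in> Arr C" "g \<in> Arr C" "Cod C f = X" "Cod C g = Y"
  shows "\<^bold>c X Y \<cdot> (f \<otimes> g) = (g \<otimes> f) \<cdot> \<^bold>c (Dom C f) (Dom C g)"
  using assms by (auto intro: Braid_natural simp: hom_iff)

lemma LUnit_Braid:
  assumes [simp]: "X \<in> Obj C"
  shows "\<^bold>l X \<cdot> \<^bold>c X \<I> = \<^bold>r X"
proof (rule TenA_unit_right_cancel)
  define g where "g = \<^bold>l X \<cdot> \<^bold>c X \<I>"
  have g [simp]: "g \<in> Arr C" "Dom C g = X \<odot> \<I>" "Cod C g = X" "iso C g" by (simp_all add: g_def)
  have "g \<cdot> (\<^bold>r X \<otimes> \<one> \<I>) = g \<cdot> ((\<one> X \<otimes> \<^bold>l \<I>) \<cdot> \<^bold>a X \<I> \<I>)"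
    by (simp only: triangle assms UnitO_Obj)
  also have "\<dots> = \<^bold>l X \<cdot> (\<^bold>c X \<I> \<cdot> (\<one> X \<otimes> \<^bold>l \<I>)) \<cdot> \<^bold>a X \<I> \<I>"
    by (simp add: g_def)
  also have "\<dots> = \<^bold>l X \<cdot> (\<^bold>l \<I> \<otimes> \<one> X) \<cdot> \<^bold>c X (\<I> \<odot> \<I>) \<cdot> \<^bold>a X \<I> \<I>"
    by (subst Braid_nat) simp_all
  also have "\<dots> = \<^bold>l X \<cdot> (\<^bold>l (\<I> \<odot> X) \<cdot> \<^bold>a \<I> \<I> X) \<cdot> \<^bold>c X (\<I> \<odot> \<I>) \<cdot> \<^bold>a X \<I> \<I>"
    by (simp only: LUnit_TenO assms UnitO_Obj)
  also have "\<dots> = \<^bold>l X \<cdot> \<^bold>l (\<I> \<odot> X) \<cdot> (\<^bold>a \<I> \<I> X \<cdot> \<^bold>c X (\<I> \<odot> \<I>) \<cdot> \<^bold>a X \<I> \<I>)"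
    by simp
  also have "\<dots> = \<^bold>l X \<cdot> \<^bold>l (\<I> \<odot> X) \<cdot> (\<one> \<I> \<otimes> \<^bold>c X \<I>) \<cdot> \<^bold>a \<I> X \<I> \<cdot> (\<^bold>c X \<I> \<otimes> \<one> \<I>)"
    by (simp only: hexagon1 assms UnitO_Obj)
  also have "\<dots> = \<^bold>l X \<cdot> (\<^bold>l (\<I> \<odot> X) \<cdot> (\<one> \<I> \<otimes> \<^bold>c X \<I>)) \<cdot> \<^bold>a \<I> X \<I> \<cdot> (\<^bold>c X \<I> \<otimes> \<one> \<I>)"
    by simp
  also have "\<dots> = g \<cdot> (\<^bold>l (X \<odot> \<I>) \<cdot> \<^bold>a \<I> X \<I>) \<cdot> (\<^bold>c X \<I> \<otimes> \<one> \<I>)"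
    by (subst LUnit_nat) (simp_all add: g_def)
  also have "\<dots> = g \<cdot> (g \<otimes> \<one> \<I>)"
    by (subst LUnit_TenO) (simp_all add: g_def)
  finally have "\<^bold>r X \<otimes> \<one> \<I> = g \<otimes> \<one> \<I>"
    by (rule iso_cancel_left) simp_all
  then show "(\<^bold>l X \<cdot> \<^bold>c X \<I>) \<otimes> \<one> \<I> = \<^bold>r X \<otimes> \<one> \<I>"
    by (simp add: g_def)
qed simp_all

lemma Braid_TenO_left:
  assumes [simp]: "X \<in> Obj C" "Y \<in> Obj C" "Z \<in> Obj C"
  shows "\<^bold>c (X \<odot> Y) Z \<cdot> Inv (\<^bold>a X Y Z) \<cdot> (\<one> X \<otimes> Inv (\<^bold>c Y Z))
    = \<^bold>a Z X Y \<cdot> (\<^bold>c X Z \<otimes> \<one> Y) \<cdot> Inv (\<^bold>a X Z Y)"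
proof -
  have "\<^bold>c (X \<odot> Y) Z \<cdot> Inv (\<^bold>a X Y Z) \<cdot> (\<one> X \<otimes> Inv (\<^bold>c Y Z))
    = \<^bold>a Z X Y \<cdot> (Inv (\<^bold>a Z X Y) \<cdot> \<^bold>c (X \<odot> Y) Z \<cdot> Inv (\<^bold>a X Y Z)) \<cdot> (\<one> X \<otimes> Inv (\<^bold>c Y Z))"
    by simp
  also have "\<dots> = \<^bold>a Z X Y \<cdot> (\<^bold>c X Z \<otimes> \<one> Y) \<cdot> Inv (\<^bold>a X Z Y)"
    by (subst hexagon2) simp_all
  finally show ?thesis .
qed

end

text \<open>Reversal swaps the two hexagons, and the roles of \<open>t1\<close> and \<open>t2\<close> in a multiplier bimonoid.\<close>

definition reverse_cat :: "('o, 'm, 'z) braided_cat_scheme \<Rightarrow> ('o, 'm, 'z) braided_cat_scheme"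
  where "reverse_cat C = C\<lparr>TenO := \<lambda>X Y. Y \<odot> X, TenA := \<lambda>f g. g \<otimes> f,
    Assoc := \<lambda>X Y Z. Inv (\<^bold>a Z Y X), LUnit := \<^bold>r, RUnit := \<^bold>l, Braid := \<lambda>X Y. \<^bold>c Y X\<rparr>"
  for C (structure)

lemma reverse_cat_simps [simp]:
  fixes C :: "('o, 'm, 'z) braided_cat_scheme" (structure)
  shows "Obj (reverse_cat C) = Obj C" "Arr (reverse_cat C) = Arr C"
    "Dom (reverse_cat C) = Dom C" "Cod (reverse_cat C) = Cod C"
    "Idt (reverse_cat C) = Idt C" "Comp (reverse_cat C) = Comp C"
    "TenO (reverse_cat C) X Y = Y \<odot> X" "TenA (reverse_cat C) f g = g \<otimes> f"
    "UnitO (reverse_cat C) = \<I>"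
    "Assoc (reverse_cat C) X Y Z = Inv (\<^bold>a Z Y X)"
    "LUnit (reverse_cat C) = \<^bold>r" "RUnit (reverse_cat C) = \<^bold>l"
    "Braid (reverse_cat C) X Y = \<^bold>c Y X"
  by (simp_all add: reverse_cat_def)

lemma reverse_cat_hom [simp]: "hom (reverse_cat C) = hom C"
  by (simp add: hom_def fun_eq_iff)

lemma reverse_cat_inverse_arrows [simp]: "inverse_arrows (reverse_cat C) = inverse_arrows C"
  by (simp add: inverse_arrows_def fun_eq_iff)

lemma reverse_cat_iso [simp]: "iso (reverse_cat C) = iso C"
  by (simp add: iso_def fun_eq_iff)

lemma reverse_cat_inv_arr [simp]: "inv_arr (reverse_cat C) = inv_arr C"
  by (simp add: inv_arr_def fun_eq_iff)

lemma reverse_cat_coequalizer [simp]: "coequalizer (reverse_cat C) = coequalizer C"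
  by (simp add: coequalizer_def fun_eq_iff)

lemma (in braided_monoidal_category) reverse_braided: "braided_monoidal_category (reverse_cat C)"
proof -
  have pentagon': "(Inv (\<^bold>a Z Y X) \<otimes> \<one> W) \<cdot> Inv (\<^bold>a Z (Y \<odot> X) W) \<cdot> (\<one> Z \<otimes> Inv (\<^bold>a Y X W))
      = Inv (\<^bold>a (Z \<odot> Y) X W) \<cdot> Inv (\<^bold>a Z Y (X \<odot> W))"
    if "W \<in> Obj C" "X \<in> Obj C" "Y \<in> Obj C" "Z \<in> Obj C" for W X Y Z
    using arg_cong [OF pentagon [of Z Y X W], of "inv_arr C"] that by simp
  have triangle': "(\<^bold>r Y \<otimes> \<one> X) \<cdot> Inv (\<^bold>a Y \<I> X) = \<one> Y \<otimes> \<^bold>l X"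
    if "X \<in> Obj C" "Y \<in> Obj C" for X Y
    using that by (simp flip: triangle)
  show ?thesis
    by unfold_locales (auto simp: hom_iff Comp_assoc Inv_Assoc_nat LUnit_nat RUnit_nat Braid_nat
      pentagon' triangle' hexagon1 hexagon2)
qed

section \<open>Multiplier bimonoids\<close>

locale multiplier_bimonoid_object = braided_monoidal_category C
  for C :: "('o, 'm, 'z) braided_cat_scheme" (structure) +
  fixes A :: 'o and t1 t2 e :: 'm
  assumes bimonoid: "multiplier_bimonoid C A t1 t2 e"
begin

lemma structure_simps [simp]:
  "A \<in> Obj C"
  "t1 \<in> Arr C" "Dom C t1 = A \<odot> A" "Cod C t1 = A \<odot> A"
  "t2 \<in> Arr C" "Dom C t2 = A \<odot> A" "Cod C t2 = A \<odot> A"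
  "e \<in> Arr C" "Dom C e = A" "Cod C e = \<I>"
  using bimonoid by (simp_all add: multiplier_bimonoid_def hom_iff)

lemma on23_simps [simp]:
  assumes "f \<in> Arr C" "Dom C f = A \<odot> A" "Cod C f = A \<odot> A"
  shows "on23 C A f \<in> Arr C" "Dom C (on23 C A f) = A \<odot> A \<odot> A" "Cod C (on23 C A f) = A \<odot> A \<odot> A"
  using assms by (simp_all add: on23_def)

lemma on23_Comp [simp]:
  assumes "f \<in> Arr C" "Dom C f = A \<odot> A" "Cod C f = A \<odot> A"
    and "g \<in> Arr C" "Dom C g = A \<odot> A" "Cod C g = A \<odot> A"
  shows "on23 C A g \<cdot> on23 C A f = on23 C A (g \<cdot> f)"
  using assms by (simp add: on23_def)

lemma on23_Idt [simp]: "on23 C A (\<one> (A \<odot> A)) = \<one> (A \<odot> A \<odot> A)"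
  by (simp add: on23_def)

lemma fusion:
  "(t1 \<otimes> \<one> A) \<cdot> (Inv (\<^bold>c A A) \<otimes> \<one> A) \<cdot> on23 C A t1 \<cdot> (\<^bold>c A A \<otimes> \<one> A) \<cdot> on23 C A t1
    = on23 C A t1 \<cdot> (t1 \<otimes> \<one> A)"
  and counit1: "(\<one> A \<otimes> e) \<cdot> t1 = \<one> A \<otimes> e"
  and fusion2:
  "on23 C A t2 \<cdot> on23 C A (Inv (\<^bold>c A A)) \<cdot> (t2 \<otimes> \<one> A) \<cdot> on23 C A (\<^bold>c A A) \<cdot> (t2 \<otimes> \<one> A)
    = (t2 \<otimes> \<one> A) \<cdot> on23 C A t2"
  and counit2: "(e \<otimes> \<one> A) \<cdot> t2 = e \<otimes> \<one> A"
  and commute: "on23 C A t1 \<cdot> (t2 \<otimes> \<one> A) = (t2 \<otimes> \<one> A) \<cdot> on23 C A t1"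
  and mult_eq: "\<^bold>l A \<cdot> (e \<otimes> \<one> A) \<cdot> t1 = \<^bold>r A \<cdot> (\<one> A \<otimes> e) \<cdot> t2"
  using bimonoid by (simp_all add: multiplier_bimonoid_def)

definition left_counit :: 'm where "left_counit = \<^bold>l A \<cdot> (e \<otimes> \<one> A)"

definition right_counit :: 'm where "right_counit = \<^bold>r A \<cdot> (\<one> A \<otimes> e)"

abbreviation m :: 'm where "m \<equiv> bimonoid_mult C A t1 e"

lemma mult_left_counit: "m = left_counit \<cdot> t1"
  by (simp add: bimonoid_mult_def left_counit_def)

lemma mult_right_counit: "m = right_counit \<cdot> t2"
  using mult_eq by (simp add: bimonoid_mult_def right_counit_def)

lemma counit_mult_simps [simp]:
  "left_counit \<in> Arr C" "Dom C left_counit = A \<odot> A" "Cod C left_counit = A"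
  "right_counit \<in> Arr C" "Dom C right_counit = A \<odot> A" "Cod C right_counit = A"
  "m \<in> Arr C" "Dom C m = A \<odot> A" "Cod C m = A"
  by (simp_all add: left_counit_def right_counit_def bimonoid_mult_def)

lemma reverse_bimonoid: "multiplier_bimonoid_object (reverse_cat C) A t2 t1 e"
proof -
  let ?a = "\<^bold>a A A A" and ?c = "\<^bold>c A A"
  let ?on12 = "\<lambda>f. ?a \<cdot> (f \<otimes> \<one> A) \<cdot> Inv ?a"
  have "(\<one> A \<otimes> t2) \<cdot> (\<one> A \<otimes> Inv ?c) \<cdot> ?on12 t2 \<cdot> (\<one> A \<otimes> ?c) \<cdot> ?on12 t2
      = ?a \<cdot> (on23 C A t2 \<cdot> on23 C A (Inv ?c) \<cdot> (t2 \<otimes> \<one> A) \<cdot> on23 C A ?c \<cdot> (t2 \<otimes> \<one> A)) \<cdot> Inv ?a"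
    by (simp add: on23_def)
  also have "\<dots> = ?on12 t2 \<cdot> (\<one> A \<otimes> t2)"
    unfolding fusion2 by (simp add: on23_def)
  finally have 1: "(\<one> A \<otimes> t2) \<cdot> (\<one> A \<otimes> Inv ?c) \<cdot> ?on12 t2 \<cdot> (\<one> A \<otimes> ?c) \<cdot> ?on12 t2
    = ?on12 t2 \<cdot> (\<one> A \<otimes> t2)" .
  have "?on12 t1 \<cdot> ?on12 (Inv ?c) \<cdot> (\<one> A \<otimes> t1) \<cdot> ?on12 ?c \<cdot> (\<one> A \<otimes> t1)
      = ?a \<cdot> ((t1 \<otimes> \<one> A) \<cdot> (Inv ?c \<otimes> \<one> A) \<cdot> on23 C A t1 \<cdot> (?c \<otimes> \<one> A) \<cdot> on23 C A t1) \<cdot> Inv ?a"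
    by (simp add: on23_def)
  also have "\<dots> = (\<one> A \<otimes> t1) \<cdot> ?on12 t1"
    unfolding fusion by (simp add: on23_def)
  finally have 2: "?on12 t1 \<cdot> ?on12 (Inv ?c) \<cdot> (\<one> A \<otimes> t1) \<cdot> ?on12 ?c \<cdot> (\<one> A \<otimes> t1)
    = (\<one> A \<otimes> t1) \<cdot> ?on12 t1" .
  have "?on12 t2 \<cdot> (\<one> A \<otimes> t1) = ?a \<cdot> ((t2 \<otimes> \<one> A) \<cdot> on23 C A t1) \<cdot> Inv ?a"
    by (simp add: on23_def)
  also have "\<dots> = (\<one> A \<otimes> t1) \<cdot> ?on12 t2"
    unfolding commute [symmetric] by (simp add: on23_def)
  finally have 3: "?on12 t2 \<cdot> (\<one> A \<otimes> t1) = (\<one> A \<otimes> t1) \<cdot> ?on12 t2" .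
  have on23_reverse: "on23 (reverse_cat C) A f = ?on12 f" for f
    by (simp add: on23_def)
  have "multiplier_bimonoid (reverse_cat C) A t2 t1 e"
    unfolding multiplier_bimonoid_def on23_reverse reverse_cat_simps reverse_cat_inv_arr reverse_cat_hom
    using 1 2 3 counit1 counit2 mult_eq by (simp only: structure_simps hom_iff TenO_Obj simp_thms)
  then show ?thesis
    by (simp add: multiplier_bimonoid_object_def multiplier_bimonoid_object_axioms_def reverse_braided)
qed

lemma reverse_mult [simp]: "bimonoid_mult (reverse_cat C) A t2 e = m"
  using mult_eq by (simp add: bimonoid_mult_def)

lemma reverse_counit [simp]:
  "multiplier_bimonoid_object.left_counit (reverse_cat C) A e = right_counit"
  "multiplier_bimonoid_object.right_counit (reverse_cat C) A e = left_counit"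
  by (simp_all add: multiplier_bimonoid_object.left_counit_def [OF reverse_bimonoid]
    multiplier_bimonoid_object.right_counit_def [OF reverse_bimonoid] left_counit_def right_counit_def)

lemma reverse_d1: "bimonoid_d1 (reverse_cat C) A t2 e = bimonoid_d2 C A t1 t2 e \<cdot> Inv (\<^bold>a A A A)"
  by (simp add: bimonoid_d1_def bimonoid_d2_def on23_def)

lemma reverse_d2: "bimonoid_d2 (reverse_cat C) A t2 t1 e = bimonoid_d1 C A t1 e \<cdot> Inv (\<^bold>a A A A)"
  by (simp add: bimonoid_d1_def bimonoid_d2_def on23_def)

lemma reverse_nondegenerate: "nondegenerate (reverse_cat C) A m \<longleftrightarrow> nondegenerate C A m"
  by (auto simp: nondegenerate_def)

lemma counit_triangle: "(\<one> A \<otimes> left_counit) \<cdot> \<^bold>a A A A = right_counit \<otimes> \<one> A"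
proof -
  have "(\<one> A \<otimes> left_counit) \<cdot> \<^bold>a A A A = (\<one> A \<otimes> \<^bold>l A) \<cdot> ((\<one> A \<otimes> (e \<otimes> \<one> A)) \<cdot> \<^bold>a A A A)"
    by (simp add: left_counit_def)
  also have "\<dots> = ((\<one> A \<otimes> \<^bold>l A) \<cdot> \<^bold>a A \<I> A) \<cdot> ((\<one> A \<otimes> e) \<otimes> \<one> A)"
    using Assoc_nat [of "\<one> A" e "\<one> A"] by simp
  also have "\<dots> = right_counit \<otimes> \<one> A"
    by (subst triangle) (simp_all add: right_counit_def)
  finally show ?thesis .
qed

lemma left_counit_TenO: "(left_counit \<otimes> \<one> A) \<cdot> Inv (\<^bold>a A A A) = \<^bold>l (A \<odot> A) \<cdot> (e \<otimes> \<one> (A \<odot> A))"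
proof -
  have "\<^bold>l (A \<odot> A) \<cdot> (e \<otimes> \<one> (A \<odot> A)) \<cdot> \<^bold>a A A A = \<^bold>l (A \<odot> A) \<cdot> \<^bold>a \<I> A A \<cdot> ((e \<otimes> \<one> A) \<otimes> \<one> A)"
    by (subst Assoc_nat) simp_all
  also have "\<dots> = (\<^bold>l (A \<odot> A) \<cdot> \<^bold>a \<I> A A) \<cdot> ((e \<otimes> \<one> A) \<otimes> \<one> A)"
    by simp
  also have "\<dots> = left_counit \<otimes> \<one> A"
    by (subst LUnit_TenO) (simp_all add: left_counit_def)
  finally have "left_counit \<otimes> \<one> A = \<^bold>l (A \<odot> A) \<cdot> (e \<otimes> \<one> (A \<odot> A)) \<cdot> \<^bold>a A A A" ..
  then show ?thesis by simp
qed

lemma counit_unit_nat: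
  assumes "f \<in> Arr C"
  shows "\<^bold>l (Cod C f) \<cdot> (e \<otimes> f) = f \<cdot> \<^bold>l (Dom C f) \<cdot> (e \<otimes> \<one> (Dom C f))"
proof -
  have "\<^bold>l (Cod C f) \<cdot> (e \<otimes> f) = (\<^bold>l (Cod C f) \<cdot> (\<one> \<I> \<otimes> f)) \<cdot> (e \<otimes> \<one> (Dom C f))"
    using assms by simp
  also have "\<dots> = f \<cdot> \<^bold>l (Dom C f) \<cdot> (e \<otimes> \<one> (Dom C f))"
    using assms by (subst LUnit_nat) simp_all
  finally show ?thesis .
qed

lemma left_counit_on23:
  assumes "f \<in> Arr C" "Dom C f = A \<odot> A" "Cod C f = A \<odot> A"
  shows "(left_counit \<otimes> \<one> A) \<cdot> on23 C A f = f \<cdot> (left_counit \<otimes> \<one> A)"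
proof -
  have "(left_counit \<otimes> \<one> A) \<cdot> on23 C A f = ((left_counit \<otimes> \<one> A) \<cdot> Inv (\<^bold>a A A A)) \<cdot> (\<one> A \<otimes> f) \<cdot> \<^bold>a A A A"
    using assms by (simp add: on23_def)
  also have "\<dots> = (\<^bold>l (A \<odot> A) \<cdot> (e \<otimes> f)) \<cdot> \<^bold>a A A A"
    unfolding left_counit_TenO using assms by simp
  also have "\<dots> = f \<cdot> (\<^bold>l (A \<odot> A) \<cdot> (e \<otimes> \<one> (A \<odot> A))) \<cdot> \<^bold>a A A A"
    using counit_unit_nat [of f] assms by simp
  also have "\<dots> = f \<cdot> (left_counit \<otimes> \<one> A)"
    unfolding left_counit_TenO [symmetric] using assms by simp
  finally show ?thesis .
qed

lemma counit_mult: "e \<cdot> m = e \<cdot> left_counit"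
proof -
  have counit_left_counit: "e \<cdot> left_counit = \<^bold>l \<I> \<cdot> (e \<otimes> e)"
    using counit_unit_nat [of e] by (simp add: left_counit_def)
  have "e \<cdot> m = (e \<cdot> left_counit) \<cdot> t1"
    by (simp add: mult_left_counit)
  also have "\<dots> = \<^bold>l \<I> \<cdot> (e \<otimes> \<one> \<I>) \<cdot> ((\<one> A \<otimes> e) \<cdot> t1)"
    by (simp add: counit_left_counit)
  also have "\<dots> = e \<cdot> left_counit"
    by (simp add: counit1 counit_left_counit)
  finally show ?thesis .
qed

lemma counit_mult': "e \<cdot> m = e \<cdot> right_counit"
  using multiplier_bimonoid_object.counit_mult [OF reverse_bimonoid] by simp

lemma left_counit_braid: "left_counit \<cdot> \<^bold>c A A = right_counit"
proof -
  have "left_counit \<cdot> \<^bold>c A A = \<^bold>l A \<cdot> \<^bold>c A \<I> \<cdot> (\<one> A \<otimes> e)"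
    by (subst Braid_nat) (simp_all add: left_counit_def)
  also have "\<dots> = (\<^bold>l A \<cdot> \<^bold>c A \<I>) \<cdot> (\<one> A \<otimes> e)"
    by simp
  also have "\<dots> = right_counit"
    by (subst LUnit_Braid) (simp_all add: right_counit_def)
  finally show ?thesis .
qed

lemma d1_simps [simp]:
  "bimonoid_d1 C A t1 e \<in> Arr C" "Dom C (bimonoid_d1 C A t1 e) = A \<odot> A \<odot> A"
  "Cod C (bimonoid_d1 C A t1 e) = A \<odot> A"
  by (simp_all add: bimonoid_d1_def)

lemma d2_simps [simp]:
  "bimonoid_d2 C A t1 t2 e \<in> Arr C" "Dom C (bimonoid_d2 C A t1 t2 e) = A \<odot> A \<odot> A"
  "Cod C (bimonoid_d2 C A t1 t2 e) = A \<odot> A"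
  by (simp_all add: bimonoid_d2_def)

lemma d1_t1: "bimonoid_d1 C A t1 e \<cdot> on23 C A t1 = t1 \<cdot> (m \<otimes> \<one> A)"
proof -
  have "bimonoid_d1 C A t1 e \<cdot> on23 C A t1 = (left_counit \<otimes> \<one> A) \<cdot>
    ((t1 \<otimes> \<one> A) \<cdot> (Inv (\<^bold>c A A) \<otimes> \<one> A) \<cdot> on23 C A t1 \<cdot> (\<^bold>c A A \<otimes> \<one> A) \<cdot> on23 C A t1)"
    by (simp add: bimonoid_d1_def mult_left_counit)
  also have "\<dots> = ((left_counit \<otimes> \<one> A) \<cdot> on23 C A t1) \<cdot> (t1 \<otimes> \<one> A)"
    unfolding fusion by simp
  also have "\<dots> = t1 \<cdot> (m \<otimes> \<one> A)"
    by (subst left_counit_on23) (simp_all add: mult_left_counit)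
  finally show ?thesis .
qed

lemma left_counit_d1: "left_counit \<cdot> bimonoid_d1 C A t1 e = m \<cdot> (right_counit \<otimes> \<one> A)"
proof -
  let ?c = "\<^bold>c A A"
  have "e \<cdot> m \<cdot> Inv ?c = (e \<cdot> right_counit) \<cdot> Inv ?c"
    by (simp flip: counit_mult')
  also have "\<dots> = e \<cdot> left_counit"
    by (simp flip: left_counit_braid)
  finally have e: "e \<cdot> m \<cdot> Inv ?c = e \<cdot> left_counit" .
  have "left_counit \<cdot> bimonoid_d1 C A t1 e
    = \<^bold>l A \<cdot> ((e \<cdot> m \<cdot> Inv ?c) \<otimes> \<one> A) \<cdot> on23 C A t1 \<cdot> (?c \<otimes> \<one> A)"
    by (simp add: bimonoid_d1_def left_counit_def)
  also have "\<dots> = left_counit \<cdot> ((left_counit \<otimes> \<one> A) \<cdot> on23 C A t1) \<cdot> (?c \<otimes> \<one> A)"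
    unfolding e by (simp add: left_counit_def)
  also have "\<dots> = m \<cdot> ((left_counit \<cdot> ?c) \<otimes> \<one> A)"
    by (subst left_counit_on23) (simp_all add: mult_left_counit)
  also have "\<dots> = m \<cdot> (right_counit \<otimes> \<one> A)"
    by (simp only: left_counit_braid)
  finally show ?thesis .
qed

lemma mult_assoc: "m \<cdot> (m \<otimes> \<one> A) = m \<cdot> (\<one> A \<otimes> m) \<cdot> \<^bold>a A A A"
proof -
  have "m \<cdot> (m \<otimes> \<one> A) = left_counit \<cdot> (t1 \<cdot> (m \<otimes> \<one> A))"
    by (simp add: mult_left_counit)
  also have "\<dots> = (left_counit \<cdot> bimonoid_d1 C A t1 e) \<cdot> on23 C A t1"
    by (simp flip: d1_t1)
  also have "\<dots> = m \<cdot> ((\<one> A \<otimes> left_counit) \<cdot> \<^bold>a A A A) \<cdot> on23 C A t1"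
    by (simp add: left_counit_d1 counit_triangle)
  also have "\<dots> = m \<cdot> (\<one> A \<otimes> m) \<cdot> \<^bold>a A A A"
    by (simp add: on23_def mult_left_counit)
  finally show ?thesis .
qed

lemma semigroup: "semigroup_obj C A m"
  by (simp add: semigroup_obj_def hom_iff mult_assoc)

section \<open>From invertible fusion morphisms to the antipode\<close>

lemma on23_Inv:
  assumes "iso C t1"
  shows "on23 C A t1 \<cdot> on23 C A (Inv t1) = \<one> (A \<odot> A \<odot> A)"
    and "on23 C A (Inv t1) \<cdot> on23 C A t1 = \<one> (A \<odot> A \<odot> A)"
  using assms by simp_all

lemma commute_Inv:
  assumes "iso C t1"
  shows "on23 C A (Inv t1) \<cdot> (t2 \<otimes> \<one> A) = (t2 \<otimes> \<one> A) \<cdot> on23 C A (Inv t1)"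
proof -
  let ?u = "on23 C A (Inv t1)" and ?t = "on23 C A t1"
  have [simp]: "?u \<in> Arr C" "Dom C ?u = A \<odot> A \<odot> A" "Cod C ?u = A \<odot> A \<odot> A"
    using assms by simp_all
  have "?u \<cdot> (t2 \<otimes> \<one> A) = ?u \<cdot> (t2 \<otimes> \<one> A) \<cdot> (?t \<cdot> ?u)"
    unfolding on23_Inv(1) [OF assms] by simp
  also have "\<dots> = ?u \<cdot> ((t2 \<otimes> \<one> A) \<cdot> ?t) \<cdot> ?u"
    by simp
  also have "\<dots> = (?u \<cdot> ?t) \<cdot> (t2 \<otimes> \<one> A) \<cdot> ?u"
    by (simp del: on23_Comp flip: commute)
  also have "\<dots> = (t2 \<otimes> \<one> A) \<cdot> ?u"
    unfolding on23_Inv(2) [OF assms] by simp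
  finally show ?thesis .
qed

lemma antipode1_eq:
  assumes "iso C t1"
  shows "(\<one> A \<otimes> (left_counit \<cdot> Inv t1)) \<cdot> \<^bold>a A A A \<cdot> (t2 \<otimes> \<one> A) = (m \<otimes> \<one> A) \<cdot> on23 C A (Inv t1)"
proof -
  have "(\<one> A \<otimes> (left_counit \<cdot> Inv t1)) \<cdot> \<^bold>a A A A \<cdot> (t2 \<otimes> \<one> A)
    = ((\<one> A \<otimes> left_counit) \<cdot> \<^bold>a A A A) \<cdot> on23 C A (Inv t1) \<cdot> (t2 \<otimes> \<one> A)"
    using assms by (simp add: on23_def)
  also have "\<dots> = (m \<otimes> \<one> A) \<cdot> on23 C A (Inv t1)"
    using assms by (simp add: counit_triangle commute_Inv mult_right_counit)
  finally show ?thesis .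
qed

lemma d1_eq_Inv:
  assumes "iso C t1"
  shows "t1 \<cdot> (\<one> A \<otimes> (left_counit \<cdot> Inv t1)) \<cdot> \<^bold>a A A A \<cdot> (t2 \<otimes> \<one> A) = bimonoid_d1 C A t1 e"
proof -
  have "t1 \<cdot> (\<one> A \<otimes> (left_counit \<cdot> Inv t1)) \<cdot> \<^bold>a A A A \<cdot> (t2 \<otimes> \<one> A)
    = (bimonoid_d1 C A t1 e \<cdot> on23 C A t1) \<cdot> on23 C A (Inv t1)"
    unfolding antipode1_eq [OF assms] d1_t1 using assms by simp
  then show ?thesis using assms by simp
qed

lemma antipode1_cancel:
  assumes s: "s \<in> hom C (A \<odot> A) A"
    and d1: "bimonoid_d1 C A t1 e = t1 \<cdot> (\<one> A \<otimes> s) \<cdot> \<^bold>a A A A \<cdot> (t2 \<otimes> \<one> A)"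
  shows "m \<cdot> (\<one> A \<otimes> s) \<cdot> \<^bold>a A A A \<cdot> (t2 \<otimes> \<one> A) = m \<cdot> (\<one> A \<otimes> left_counit) \<cdot> \<^bold>a A A A"
  using left_counit_d1 s unfolding d1 by (simp add: hom_iff mult_left_counit counit_triangle)

lemma antipode2_cancel:
  assumes s: "s \<in> hom C (A \<odot> A) A"
    and d2: "bimonoid_d2 C A t1 t2 e = t2 \<cdot> (s \<otimes> \<one> A) \<cdot> on23 C A t1"
  shows "m \<cdot> (s \<otimes> \<one> A) \<cdot> Inv (\<^bold>a A A A) \<cdot> (\<one> A \<otimes> t1) = m \<cdot> (\<one> A \<otimes> left_counit)"
proof -
  have "m \<cdot> (s \<otimes> \<one> A) \<cdot> Inv (\<^bold>a A A A) \<cdot> (\<one> A \<otimes> t1) = m \<cdot> (right_counit \<otimes> \<one> A) \<cdot> Inv (\<^bold>a A A A)"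
    using multiplier_bimonoid_object.antipode1_cancel [OF reverse_bimonoid, of s] s
    by (simp add: reverse_d1 d2 on23_def hom_iff)
  then show ?thesis by (simp flip: counit_triangle)
qed

lemma d2_eq_Inv:
  assumes "iso C t2"
  shows "t2 \<cdot> ((right_counit \<cdot> Inv t2) \<otimes> \<one> A) \<cdot> on23 C A t1 = bimonoid_d2 C A t1 t2 e"
proof -
  have "t2 \<cdot> ((right_counit \<cdot> Inv t2) \<otimes> \<one> A) \<cdot> on23 C A t1
    = (t2 \<cdot> ((right_counit \<cdot> Inv t2) \<otimes> \<one> A) \<cdot> Inv (\<^bold>a A A A) \<cdot> (\<one> A \<otimes> t1)) \<cdot> \<^bold>a A A A"
    using assms by (simp add: on23_def)
  also have "\<dots> = (bimonoid_d2 C A t1 t2 e \<cdot> Inv (\<^bold>a A A A)) \<cdot> \<^bold>a A A A"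
    using multiplier_bimonoid_object.d1_eq_Inv [OF reverse_bimonoid] assms by (simp add: reverse_d1)
  also have "\<dots> = bimonoid_d2 C A t1 t2 e" by simp
  finally show ?thesis .
qed

lemma antipode_Inv:
  assumes iso: "iso C t1" "iso C t2" and nd: "nondegenerate C A m"
  shows "antipode C A t1 t2 e (left_counit \<cdot> Inv t1, right_counit \<cdot> Inv t2)"
proof -
  let ?s1 = "left_counit \<cdot> Inv t1" and ?s2 = "right_counit \<cdot> Inv t2"
  have s [simp]: "?s1 \<in> Arr C" "Dom C ?s1 = A \<odot> A" "Cod C ?s1 = A"
    "?s2 \<in> Arr C" "Dom C ?s2 = A \<odot> A" "Cod C ?s2 = A"
    using iso by simp_all
  have "(m \<cdot> (?s2 \<otimes> \<one> A)) \<cdot> on23 C A t1 = (m \<cdot> (?s2 \<otimes> \<one> A) \<cdot> Inv (\<^bold>a A A A) \<cdot> (\<one> A \<otimes> t1)) \<cdot> \<^bold>a A A A"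
    using iso by (simp add: on23_def)
  also have "\<dots> = (m \<cdot> (\<one> A \<otimes> left_counit)) \<cdot> \<^bold>a A A A"
    by (subst antipode2_cancel) (use iso in \<open>simp_all add: d2_eq_Inv hom_iff\<close>)
  also have "\<dots> = (m \<cdot> (\<one> A \<otimes> ?s1) \<cdot> \<^bold>a A A A) \<cdot> on23 C A t1"
    using iso by (simp add: on23_def)
  finally have "m \<cdot> (\<one> A \<otimes> ?s1) \<cdot> \<^bold>a A A A = m \<cdot> (?s2 \<otimes> \<one> A)"
    by (rule iso_cancel_right [OF sym]) (use iso in \<open>simp_all add: on23_def\<close>)
  then show ?thesis
    using iso nd by (simp add: antipode_def M_morphism_def semigroup hom_iff d1_eq_Inv d2_eq_Inv)
qed

lemma antipode1_unique:
  assumes iso: "iso C t1" "iso C t2" and epi: "coequalizer C u v (e \<otimes> \<one> (A \<odot> A))"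
    and s: "s \<in> hom C (A \<odot> A) A"
    and d1: "bimonoid_d1 C A t1 e = t1 \<cdot> (\<one> A \<otimes> s) \<cdot> \<^bold>a A A A \<cdot> (t2 \<otimes> \<one> A)"
  shows "s = left_counit \<cdot> Inv t1"
proof -
  let ?s = "left_counit \<cdot> Inv t1" and ?b = "\<^bold>a A A A \<cdot> (t2 \<otimes> \<one> A)"
  have s': "s \<in> Arr C" "Dom C s = A \<odot> A" "Cod C s = A"
    using s by (simp_all add: hom_iff)
  have s'': "?s \<in> Arr C" "Dom C ?s = A \<odot> A" "Cod C ?s = A"
    using iso by simp_all
  have "t1 \<cdot> ((\<one> A \<otimes> s) \<cdot> ?b) = t1 \<cdot> ((\<one> A \<otimes> ?s) \<cdot> ?b)"
    using iso s' by (simp add: d1_eq_Inv flip: d1)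
  then have "(\<one> A \<otimes> s) \<cdot> ?b = (\<one> A \<otimes> ?s) \<cdot> ?b"
    by (rule iso_cancel_left) (use iso s' in simp_all)
  then have eq: "\<one> A \<otimes> s = \<one> A \<otimes> ?s"
    by (rule iso_cancel_right) (use iso s' in simp_all)
  have "(f \<cdot> \<^bold>l (A \<odot> A)) \<cdot> (e \<otimes> \<one> (A \<odot> A)) = \<^bold>l A \<cdot> (e \<otimes> \<one> A) \<cdot> (\<one> A \<otimes> f)"
    if "f \<in> Arr C" "Dom C f = A \<odot> A" "Cod C f = A" for f
    using counit_unit_nat [of f] that by simp
  from this [OF s'] this [OF s'']
  have "(s \<cdot> \<^bold>l (A \<odot> A)) \<cdot> (e \<otimes> \<one> (A \<odot> A)) = (?s \<cdot> \<^bold>l (A \<odot> A)) \<cdot> (e \<otimes> \<one> (A \<odot> A))"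
    unfolding eq by (rule trans [OF _ sym])
  then have "s \<cdot> \<^bold>l (A \<odot> A) = ?s \<cdot> \<^bold>l (A \<odot> A)"
    by (rule coequalizer_epi [OF epi]) (use iso s' in simp_all)
  then show ?thesis
    by (rule iso_cancel_right) (use iso s' in simp_all)
qed

section \<open>From the antipode to invertible fusion morphisms\<close>

lemma nondegenerate_cancel:
  assumes "nondegenerate C A m"
    and "(m \<otimes> \<one> A) \<cdot> Inv (\<^bold>a A A A) \<cdot> (\<one> A \<otimes> f) = (m \<otimes> \<one> A) \<cdot> Inv (\<^bold>a A A A) \<cdot> (\<one> A \<otimes> g)"
    and "f \<in> hom C X (A \<odot> A)" "g \<in> hom C X (A \<odot> A)"
  shows "f = g"
proof -
  have "X \<in> Obj C" using assms(3) by (auto simp: hom_iff)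
  then have "inj_on (\<lambda>g. (m \<otimes> \<one> A) \<cdot> Inv (\<^bold>a A A A) \<cdot> (\<one> A \<otimes> g)) (hom C X (A \<odot> A))"
    using assms(1) by (simp add: nondegenerate_def)
  then show ?thesis using assms(2-) by (rule inj_onD)
qed

lemma t1_mono:
  assumes nd: "nondegenerate C A m"
    and s: "s \<in> hom C (A \<odot> A) A"
    and d2: "bimonoid_d2 C A t1 t2 e = t2 \<cdot> (s \<otimes> \<one> A) \<cdot> on23 C A t1"
    and f: "f \<in> hom C X (A \<odot> A)" and g: "g \<in> hom C X (A \<odot> A)" and eq: "t1 \<cdot> f = t1 \<cdot> g"
  shows "f = g"
proof -
  have [simp]: "s \<in> Arr C" "Dom C s = A \<odot> A" "Cod C s = A"
    using s by (simp_all add: hom_iff)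
  have X [simp]: "X \<in> Obj C" using f by (auto simp: hom_iff)
  let ?a = "\<^bold>a A A A" and ?c = "\<^bold>c A A"
  \<comment> \<open>\<open>?\<kappa>\<close> carries an auxiliary first factor to the place where \<open>s\<close> can multiply it.\<close>
  let ?\<kappa> = "\<lambda>Y. \<^bold>a A A Y \<cdot> (?c \<otimes> \<one> Y) \<cdot> Inv (\<^bold>a A A Y)"
  let ?\<tau> = "?a \<cdot> (t2 \<otimes> \<one> A) \<cdot> Inv ?a"
  let ?M = "m \<cdot> (s \<otimes> \<one> A) \<cdot> Inv ?a"
  let ?H = "\<lambda>h. (m \<otimes> \<one> A) \<cdot> Inv ?a \<cdot> (\<one> A \<otimes> h)"
  have \<kappa>: "?\<kappa> (Cod C k) \<cdot> (\<one> A \<otimes> (\<one> A \<otimes> k)) = (\<one> A \<otimes> (\<one> A \<otimes> k)) \<cdot> ?\<kappa> (Dom C k)"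
    if [simp]: "k \<in> Arr C" for k
  proof -
    have "?\<kappa> (Cod C k) \<cdot> (\<one> A \<otimes> (\<one> A \<otimes> k))
      = \<^bold>a A A (Cod C k) \<cdot> (?c \<otimes> \<one> (Cod C k)) \<cdot> (Inv (\<^bold>a A A (Cod C k)) \<cdot> (\<one> A \<otimes> (\<one> A \<otimes> k)))"
      by simp
    also have "\<dots> = (\<^bold>a A A (Cod C k) \<cdot> ((\<one> A \<otimes> \<one> A) \<otimes> k)) \<cdot> (?c \<otimes> \<one> (Dom C k)) \<cdot> Inv (\<^bold>a A A (Dom C k))"
      by (subst Inv_Assoc_nat) simp_all
    also have "\<dots> = (\<one> A \<otimes> (\<one> A \<otimes> k)) \<cdot> ?\<kappa> (Dom C k)"
      by (subst Assoc_nat) simp_all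
    finally show ?thesis .
  qed
  have \<tau>: "?\<tau> \<cdot> (\<one> A \<otimes> t1) = (\<one> A \<otimes> t1) \<cdot> ?\<tau>"
  proof -
    have "?\<tau> \<cdot> (\<one> A \<otimes> t1) = ?a \<cdot> ((t2 \<otimes> \<one> A) \<cdot> on23 C A t1) \<cdot> Inv ?a"
      by (simp add: on23_def)
    also have "\<dots> = (\<one> A \<otimes> t1) \<cdot> ?\<tau>"
      unfolding commute [symmetric] by (simp add: on23_def)
    finally show ?thesis .
  qed
  have H: "(\<one> A \<otimes> m) \<cdot> ?\<kappa> A \<cdot> (\<one> A \<otimes> ?H h)
      = (\<one> A \<otimes> ?M) \<cdot> ?\<kappa> (A \<odot> A) \<cdot> (\<one> A \<otimes> (?\<tau> \<cdot> (\<one> A \<otimes> (t1 \<cdot> h))))"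
    if [simp]: "h \<in> Arr C" "Dom C h = X" "Cod C h = A \<odot> A" for h
  proof -
    have "?H h = ((\<one> A \<otimes> left_counit) \<cdot> ?a) \<cdot> (t2 \<otimes> \<one> A) \<cdot> Inv ?a \<cdot> (\<one> A \<otimes> h)"
      unfolding counit_triangle by (simp add: mult_right_counit)
    then have "(\<one> A \<otimes> m) \<cdot> ?\<kappa> A \<cdot> (\<one> A \<otimes> ?H h)
      = (\<one> A \<otimes> m) \<cdot> (?\<kappa> A \<cdot> (\<one> A \<otimes> (\<one> A \<otimes> left_counit))) \<cdot> (\<one> A \<otimes> (?\<tau> \<cdot> (\<one> A \<otimes> h)))"
      by simp
    also have "\<dots> = (\<one> A \<otimes> (m \<cdot> (\<one> A \<otimes> left_counit))) \<cdot> ?\<kappa> (A \<odot> A) \<cdot> (\<one> A \<otimes> (?\<tau> \<cdot> (\<one> A \<otimes> h)))"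
      using \<kappa> [of left_counit] by simp
    also have "\<dots> = (\<one> A \<otimes> ?M) \<cdot> ((\<one> A \<otimes> (\<one> A \<otimes> t1)) \<cdot> ?\<kappa> (A \<odot> A)) \<cdot> (\<one> A \<otimes> (?\<tau> \<cdot> (\<one> A \<otimes> h)))"
      by (simp flip: antipode2_cancel [OF s d2])
    also have "\<dots> = (\<one> A \<otimes> ?M) \<cdot> (?\<kappa> (A \<odot> A) \<cdot> (\<one> A \<otimes> (\<one> A \<otimes> t1))) \<cdot> (\<one> A \<otimes> (?\<tau> \<cdot> (\<one> A \<otimes> h)))"
      using \<kappa> [of t1] by simp
    also have "\<dots> = (\<one> A \<otimes> ?M) \<cdot> ?\<kappa> (A \<odot> A) \<cdot> (\<one> A \<otimes> (((\<one> A \<otimes> t1) \<cdot> ?\<tau>) \<cdot> (\<one> A \<otimes> h)))"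
      by simp
    also have "\<dots> = (\<one> A \<otimes> ?M) \<cdot> ?\<kappa> (A \<odot> A) \<cdot> (\<one> A \<otimes> (?\<tau> \<cdot> (\<one> A \<otimes> (t1 \<cdot> h))))"
      unfolding \<tau> [symmetric] by simp
    finally show ?thesis .
  qed
  have c: "(\<one> A \<otimes> m) \<cdot> ?\<kappa> A \<cdot> (\<one> A \<otimes> k) = ?c \<cdot> ?H (Inv ?c \<cdot> k)"
    if [simp]: "k \<in> Arr C" "Cod C k = A \<odot> A" for k
  proof -
    have "?c \<cdot> ?H (Inv ?c \<cdot> k)
      = (?c \<cdot> (m \<otimes> \<one> A)) \<cdot> Inv ?a \<cdot> (\<one> A \<otimes> Inv ?c) \<cdot> (\<one> A \<otimes> k)"
      by simp
    also have "\<dots> = (\<one> A \<otimes> m) \<cdot> (\<^bold>c (A \<odot> A) A \<cdot> Inv ?a \<cdot> (\<one> A \<otimes> Inv ?c)) \<cdot> (\<one> A \<otimes> k)"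
      by (subst Braid_nat) simp_all
    also have "\<dots> = (\<one> A \<otimes> m) \<cdot> ?\<kappa> A \<cdot> (\<one> A \<otimes> k)"
      by (subst Braid_TenO_left) simp_all
    finally show ?thesis ..
  qed
  have f' [simp]: "f \<in> Arr C" "Dom C f = X" "Cod C f = A \<odot> A"
    and g' [simp]: "g \<in> Arr C" "Dom C g = X" "Cod C g = A \<odot> A"
    using f g by (simp_all add: hom_iff)
  have "?c \<cdot> ?H (Inv ?c \<cdot> ?H f) = (\<one> A \<otimes> m) \<cdot> ?\<kappa> A \<cdot> (\<one> A \<otimes> ?H f)"
    by (rule c [symmetric]) simp_all
  also have "\<dots> = (\<one> A \<otimes> m) \<cdot> ?\<kappa> A \<cdot> (\<one> A \<otimes> ?H g)"
    unfolding H [OF f'] H [OF g'] eq ..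
  also have "\<dots> = ?c \<cdot> ?H (Inv ?c \<cdot> ?H g)"
    by (rule c) simp_all
  finally have "?H (Inv ?c \<cdot> ?H f) = ?H (Inv ?c \<cdot> ?H g)"
    by (rule iso_cancel_left) simp_all
  then have "Inv ?c \<cdot> ?H f = Inv ?c \<cdot> ?H g"
    by (rule nondegenerate_cancel [OF nd]) (simp_all add: hom_iff)
  then have "?H f = ?H g"
    by (rule iso_cancel_left) simp_all
  then show ?thesis
    by (rule nondegenerate_cancel [OF nd _ f g])
qed

lemma t1_iso:
  assumes nd: "nondegenerate C A m"
    and s1: "s1 \<in> hom C (A \<odot> A) A"
    and d1: "bimonoid_d1 C A t1 e = t1 \<cdot> (\<one> A \<otimes> s1) \<cdot> \<^bold>a A A A \<cdot> (t2 \<otimes> \<one> A)"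
    and s2: "s2 \<in> hom C (A \<odot> A) A"
    and d2: "bimonoid_d2 C A t1 t2 e = t2 \<cdot> (s2 \<otimes> \<one> A) \<cdot> on23 C A t1"
    and epi: "regular_epi C (bimonoid_d1 C A t1 e)"
  shows "iso C t1"
proof -
  have [simp]: "s1 \<in> Arr C" "Dom C s1 = A \<odot> A" "Cod C s1 = A"
    using s1 by (simp_all add: hom_iff)
  obtain u v where "coequalizer C u v (t1 \<cdot> (\<one> A \<otimes> s1) \<cdot> \<^bold>a A A A \<cdot> (t2 \<otimes> \<one> A))"
    using epi by (auto simp: regular_epi_def d1)
  then show ?thesis
  proof (rule iso_if_mono_comp_coequalizer [rotated])
    show "f = g" if "f \<in> hom C X (Dom C t1)" "g \<in> hom C X (Dom C t1)" "t1 \<cdot> f = t1 \<cdot> g" for X f g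
      using t1_mono [OF nd s2 d2] that by simp
  qed simp_all
qed

lemma
  assumes s: "antipode C A t1 t2 e s"
    and epi: "regular_epi C (bimonoid_d1 C A t1 e)"
      "regular_epi C (bimonoid_d2 C A t1 t2 e \<cdot> Inv (\<^bold>a A A A))"
  shows antipode_imp_t1_iso: "iso C t1" and antipode_imp_t2_iso: "iso C t2"
proof -
  note s' = s [unfolded antipode_def M_morphism_def]
  show "iso C t1"
    by (rule t1_iso [of "fst s" "snd s"]) (use s' epi in simp_all)
  have d1: "bimonoid_d1 C A t1 e \<cdot> Inv (\<^bold>a A A A)
      = t1 \<cdot> (\<one> A \<otimes> fst s) \<cdot> \<^bold>a A A A \<cdot> (t2 \<otimes> \<one> A) \<cdot> Inv (\<^bold>a A A A)"
    and d2: "bimonoid_d2 C A t1 t2 e \<cdot> Inv (\<^bold>a A A A) = t2 \<cdot> (snd s \<otimes> \<one> A) \<cdot> Inv (\<^bold>a A A A) \<cdot> (\<one> A \<otimes> t1)"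
    using s' by (simp_all add: on23_def hom_iff)
  show "iso C t2"
    using multiplier_bimonoid_object.t1_iso [OF reverse_bimonoid, of "snd s" "fst s"] s' epi(2)
    by (simp add: reverse_d1 reverse_d2 reverse_nondegenerate d1 d2 regular_epi_def on23_def hom_iff)
qed

lemma antipode_eq:
  assumes iso: "iso C t1" "iso C t2" and s: "antipode C A t1 t2 e s"
    and epi: "coequalizer C u v (e \<otimes> \<one> (A \<odot> A))" "coequalizer C u' v' (\<one> (A \<odot> A) \<otimes> e)"
  shows "s = (left_counit \<cdot> Inv t1, right_counit \<cdot> Inv t2)"
proof -
  note s' = s [unfolded antipode_def M_morphism_def]
  have "fst s = left_counit \<cdot> Inv t1"
    by (rule antipode1_unique [OF iso epi(1)]) (use s' in simp_all)
  moreover have "snd s = right_counit \<cdot> Inv t2"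
  proof -
    have [simp]: "snd s \<in> Arr C" "Dom C (snd s) = A \<odot> A" "Cod C (snd s) = A"
      using s' by (simp_all add: hom_iff)
    have "bimonoid_d2 C A t1 t2 e \<cdot> Inv (\<^bold>a A A A) = t2 \<cdot> (snd s \<otimes> \<one> A) \<cdot> Inv (\<^bold>a A A A) \<cdot> (\<one> A \<otimes> t1)"
      using s' by (simp add: on23_def)
    then show ?thesis
      using multiplier_bimonoid_object.antipode1_unique [OF reverse_bimonoid, of u' v' "snd s"] iso epi(2)
      by (simp add: reverse_d1 hom_iff)
  qed
  ultimately show ?thesis by (simp add: prod_eq_iff)
qed

end

theorem theorem3p9:
  fixes C :: "('o, 'm, 'z) braided_cat_scheme"
    and Q :: "'m set" and A :: 'o and t1 t2 e :: 'm
  assumes "braided_monoidal_category C"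
    and "regular_epi_class C Q"
    and "multiplier_bimonoid C A t1 t2 e"
    and "nondegenerate C A (bimonoid_mult C A t1 e)"
    and "bimonoid_mult C A t1 e \<in> Q"
    and "e \<in> Q"
    and "bimonoid_d1 C A t1 e \<in> Q"
    and "bimonoid_d2 C A t1 t2 e \<in> Q"
  shows "(multiplier_Hopf_monoid C A t1 t2 e \<longleftrightarrow> (\<exists>s. antipode C A t1 t2 e s)) \<and>
    (\<forall>s s'. antipode C A t1 t2 e s \<and> antipode C A t1 t2 e s' \<longrightarrow> s = s') \<and>
    (\<forall>s. antipode C A t1 t2 e s \<longrightarrow> dense_M Q s)"
proof -
  interpret multiplier_bimonoid_object C A t1 t2 e
    using assms(1,3) by (simp add: multiplier_bimonoid_object_def multiplier_bimonoid_object_axioms_def)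
  interpret Q: regular_epi_class C Q by (rule assms(2))
  let ?s = "(Comp C left_counit (inv_arr C t1), Comp C right_counit (inv_arr C t2))"
  have "Comp C (bimonoid_d2 C A t1 t2 e) (inv_arr C (Assoc C A A A)) \<in> Q"
    by (rule Q.Q_Comp [OF Q.Q_iso assms(8)]) simp_all
  then have iso: "iso C t1" "iso C t2" if "antipode C A t1 t2 e s" for s
    using antipode_imp_t1_iso antipode_imp_t2_iso that assms(7) Q.Q_regular_epi by blast+
  obtain u v u' v' where "coequalizer C u v (TenA C e (Idt C (TenO C A A)))"
    "coequalizer C u' v' (TenA C (Idt C (TenO C A A)) e)"
    using Q.Q_preserved [OF assms(6)] TenO_Obj structure_simps(1) by metis
  then have unique: "s = ?s" if "antipode C A t1 t2 e s" for s
    using antipode_eq iso [OF that] that by blast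
  have "dense_M Q ?s" if "iso C t1" "iso C t2"
    unfolding dense_M_def fst_conv snd_conv left_counit_def right_counit_def
    by (intro conjI Q.Q_Comp Q.Q_TenA Q.Q_iso assms(6)) (use that in simp_all)
  then have "dense_M Q s" if "antipode C A t1 t2 e s" for s
    using unique iso that by metis
  then show ?thesis
    using antipode_Inv [OF _ _ assms(4)] iso unique assms(3) unfolding multiplier_Hopf_monoid_def by metis
qed

end
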